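(* Let $n\ge2$, let $\Omega\subset\mathbb{R}^n$ be a domain, $\alpha\in[0,1)$ and $p\in[1,\frac{n}{1-\alpha})$. Then there exists a constant $C_2=C_2(n,p,\alpha,F)>0$ such that for every $v\in C_c^\infty(\Omega)$ \[ \big\|d_F^{1/p'-\alpha}v\big\|^p_{L^{p^{*,\alpha}}(\Omega)}\le C_2\int_\Omega\Big(\frac{|v|^p}{d_F}+d_F^{p-1}F^p(\nabla v)\Big)dx, \] where $p'$ is the Hölder conjugate of $p$ (with $1/p'=0$ if $p=1$).
   Context: A domain is a connected open set $\Omega\subset\mathbb{R}^n$ with nonempty boundary. $F:\mathbb{R}^n\to[0,\infty)$ is a strictly convex norm (an even, positively $1$-homogeneous convex function, positive except at the origin, whose unit ball $\{F<1\}$ is strictly convex), with $F\in C^1(\mathbb{R}^n\setminus\{0\})$. Its polar is $F^o(\eta)=\sup_{\xi\ne0}\frac{\xi\cdot\eta}{F(\xi)}$. The anisotropic distance to the boundary is $d_F(x)=\inf_{y\in\partial\Omega}F^o(x-y)$, $x\in\overline\Omega$. For $\alpha\in[0,1)$ and $1\le p<\frac{n}{1-\alpha}$, $p^{*,\alpha}:=\frac{np}{n-p(1-\alpha)}$. *)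

theory Defs
  imports "HOL-Analysis.Analysis"
begin

definition grad :: "('a::euclidean_space \<Rightarrow> real) \<Rightarrow> 'a \<Rightarrow> 'a" where
  "grad f x = (\<Sum>b\<in>Basis. frechet_derivative f (at x) b *\<^sub>R b)"

fun Ck :: "nat \<Rightarrow> ('a::euclidean_space \<Rightarrow> real) \<Rightarrow> bool" where
  "Ck 0 f = continuous_on UNIV f"
| "Ck (Suc k) f = (continuous_on UNIV f \<and> (\<forall>x. f differentiable (at x)) \<and>
      (\<forall>b\<in>Basis. Ck k (\<lambda>x. frechet_derivative f (at x) b)))"

definition smooth :: "('a::euclidean_space \<Rightarrow> real) \<Rightarrow> bool" where
  "smooth f = (\<forall>k. Ck k f)"

text \<open>C_c^infty(Omega): smooth functions (extended by zero to all of R^n) whose support is compact and contained in Omega.\<close>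
definition Cc_infty :: "'a::euclidean_space set \<Rightarrow> ('a \<Rightarrow> real) set" where
  "Cc_infty \<Omega> = {v. smooth v \<and> compact (closure {x. v x \<noteq> 0}) \<and> closure {x. v x \<noteq> 0} \<subseteq> \<Omega>}"

definition domain :: "'a::euclidean_space set \<Rightarrow> bool" where
  "domain \<Omega> = (open \<Omega> \<and> connected \<Omega> \<and> \<Omega> \<noteq> {} \<and> frontier \<Omega> \<noteq> {})"

definition strictly_convex_set :: "'a::euclidean_space set \<Rightarrow> bool" where
  "strictly_convex_set K = (\<forall>x\<in>closure K. \<forall>y\<in>closure K. \<forall>t::real. x \<noteq> y \<and> 0 < t \<and> t < 1
      \<longrightarrow> (1 - t) *\<^sub>R x + t *\<^sub>R y \<in> interior K)"

definition strictly_convex_C1_norm :: "('a::euclidean_space \<Rightarrow> real) \<Rightarrow> bool" where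
  "strictly_convex_C1_norm F = (
     (\<forall>x. F x \<ge> 0) \<and>
     (\<forall>x. F (- x) = F x) \<and>
     (\<forall>t x. t > 0 \<longrightarrow> F (t *\<^sub>R x) = t * F x) \<and>
     convex_on UNIV F \<and>
     (\<forall>x. x \<noteq> 0 \<longrightarrow> F x > 0) \<and>
     strictly_convex_set {x. F x < 1} \<and>
     (\<forall>x. x \<noteq> 0 \<longrightarrow> F differentiable (at x)) \<and>
     continuous_on (UNIV - {0}) (grad F))"

definition polar :: "('a::euclidean_space \<Rightarrow> real) \<Rightarrow> 'a \<Rightarrow> real" where
  "polar F \<eta> = (SUP \<xi>\<in>UNIV - {0}. (\<xi> \<bullet> \<eta>) / F \<xi>)"

definition dF :: "('a::euclidean_space \<Rightarrow> real) \<Rightarrow> 'a set \<Rightarrow> 'a \<Rightarrow> real" where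
  "dF F \<Omega> x = (INF y\<in>frontier \<Omega>. polar F (x - y))"

end

theory Submission
  imports Defs
begin

text \<open>
  Write d for the distance function, n for the dimension, and t = p (1 - alpha), so that the
  target exponent is q = np / (n - t). Since d is Lipschitz, the Gagliardo-Nirenberg inequality
  in L^1 applies to f = d^a |v|^s, whose gradient is controlled by
  d^(a-1) |v|^s + d^a |v|^(s-1) |grad v|.

  Let P = |v|^p / d + d^(p-1) |grad v|^p be the energy density. If t \<le> 1, take a = 0, s = p:
  the gradient is at most p P, which bounds v in L^(pn/(n-1)), and Hoelder's inequality
  interpolates with the bound for |v|^p / d in L^1. If t > 1, choose a, s such that
  f^(n/(n-1)) is the integrand W on the left-hand side. Then the gradient is at most
  const * P^(1/t) W^(1-1/t), and after Hoelder's inequality the power of the integral of W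
  on the right is absorbed on the left.
\<close>

section \<open>Hoelder's inequality\<close>

text \<open>The split at t = 1 is forced by signs: the exponent a = (n - 1)(t - 1)/(n - t) and the
  interpolation exponent 1 - 1/t are both negative for t < 1, so there the negative power of d has
  to come from |v|^p / d instead. For t > 1 absorption leaves the exponent (n - 1)/n - (1 - 1/t) =
  (n - t)/(nt), positive because t < n; it is legitimate because W has a finite integral, v having
  compact support. The pointwise bound trades |v| for d |grad v|, which needs 1 - 1/t \<le> 1 - 1/p,
  that is t \<le> p, that is \<alpha> \<ge> 0. The constant is uniform in the domain because the
  domain enters only through d, and d only through positivity and its Lipschitz constant 1/c, where
  c |x| \<le> F x. Since d need not be differentiable, pointwise upper slopes replace
  almost-everywhere derivatives, and line integrals are taken only of continuous majorants.\<close>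

lemma weighted_arith_geom_mean:
  fixes x w :: "'i \<Rightarrow> real"
  assumes "finite S" and w: "\<And>i. i \<in> S \<Longrightarrow> w i \<ge> 0" "sum w S = 1"
    and x: "\<And>i. i \<in> S \<Longrightarrow> x i \<ge> 0"
  shows "(\<Prod>i\<in>S. x i powr w i) \<le> (\<Sum>i\<in>S. w i * x i)"
proof (cases "\<exists>i\<in>S. x i = 0")
  case True
  \<comment> \<open>\<open>0 powr w = 0\<close> for every w, including w = 0, so a vanishing
    \<open>x i\<close> kills the product whatever its weight.\<close>
  then have "(\<Prod>i\<in>S. x i powr w i) = 0"
    using \<open>finite S\<close> by (auto intro!: prod_zero)
  then show ?thesis
    by (simp add: sum_nonneg w x)
next
  case False
  then have pos: "\<And>i. i \<in> S \<Longrightarrow> x i > 0"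
    using x by force
  have S: "S \<noteq> {}"
    using w by auto
  have "(\<Sum>i\<in>S. w i * ln (x i)) \<le> ln (\<Sum>i\<in>S. w i *\<^sub>R x i)"
    by (rule concave_on_sum[OF _ _ ln_concave]) (use assms pos S in auto)
  moreover obtain j where j: "j \<in> S" "w j > 0"
    using w by (metis less_eq_real_def sum.neutral zero_neq_one)
  then have "(\<Sum>i\<in>S. w i * x i) > 0"
    by (intro sum_pos2[of S j]) (use assms pos in auto)
  ultimately have "exp (\<Sum>i\<in>S. w i * ln (x i)) \<le> (\<Sum>i\<in>S. w i * x i)"
    by (simp add: ln_ge_iff)
  moreover have "exp (\<Sum>i\<in>S. w i * ln (x i)) = (\<Prod>i\<in>S. x i powr w i)"
    using \<open>finite S\<close> False by (auto simp: exp_sum powr_def intro!: prod.cong)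
  ultimately show ?thesis by simp
qed

text \<open>Each \<open>h i\<close> is divided by its bound \<open>H i\<close>, the weighted mean
  inequality is applied pointwise, and after integration the weights sum to 1. A finite family of
  factors is allowed because Gagliardo's induction has n - 1 of them; real bounds \<open>H i\<close>
  in place of the integrals keep the right-hand side finite.\<close>

lemma nn_integral_Holder:
  fixes h :: "'i \<Rightarrow> 'b \<Rightarrow> real"
  assumes "finite S" and w: "\<And>i. i \<in> S \<Longrightarrow> w i \<ge> 0" "sum w S = 1"
    and [measurable]: "\<And>i. i \<in> S \<Longrightarrow> h i \<in> borel_measurable M"
    and h: "\<And>i x. i \<in> S \<Longrightarrow> h i x \<ge> 0"
    and H: "\<And>i. i \<in> S \<Longrightarrow> H i \<ge> 0" "\<And>i. i \<in> S \<Longrightarrow> (\<integral>\<^sup>+x. ennreal (h i x) \<partial>M) \<le> ennreal (H i)"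
  shows "(\<integral>\<^sup>+x. ennreal (\<Prod>i\<in>S. h i x powr w i) \<partial>M) \<le> ennreal (\<Prod>i\<in>S. H i powr w i)"
proof (cases "\<exists>i\<in>S. H i = 0")
  case True
  \<comment> \<open>Division by \<open>H i\<close> is impossible here, but then \<open>h i\<close>
    vanishes almost everywhere and the product with it.\<close>
  then obtain i where i: "i \<in> S" "H i = 0" by blast
  then have "(\<integral>\<^sup>+x. ennreal (h i x) \<partial>M) = 0"
    using H(2)[of i] by simp
  then have "AE x in M. ennreal (h i x) = 0"
    using i by (subst (asm) nn_integral_0_iff_AE) auto
  then have "AE x in M. ennreal (\<Prod>i\<in>S. h i x powr w i) = 0"
  proof eventually_elim
    case (elim x)
    then have "h i x = 0"
      using h[OF i(1), of x] by simp
    then have "(\<Prod>i\<in>S. h i x powr w i) = 0"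
      using i(1) \<open>finite S\<close> by (auto intro!: prod_zero)
    then show ?case by simp
  qed
  then have "(\<integral>\<^sup>+x. ennreal (\<Prod>i\<in>S. h i x powr w i) \<partial>M) = 0"
    by (subst nn_integral_0_iff_AE) auto
  then show ?thesis by simp
next
  case False
  then have pos: "\<And>i. i \<in> S \<Longrightarrow> H i > 0"
    using H(1) by force
  define c where "c = (\<Prod>i\<in>S. H i powr w i)"
  have c: "c \<ge> 0" unfolding c_def by (simp add: prod_nonneg)
  have "(\<Prod>i\<in>S. h i x powr w i) \<le> c * (\<Sum>i\<in>S. w i * (h i x / H i))" for x
  proof -
    have "(\<Prod>i\<in>S. h i x powr w i) = (\<Prod>i\<in>S. H i powr w i * (h i x / H i) powr w i)"
      by (intro prod.cong refl, subst powr_mult[symmetric]) (use False in auto)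
    also have "\<dots> = c * (\<Prod>i\<in>S. (h i x / H i) powr w i)"
      by (simp add: prod.distrib c_def)
    also have "\<dots> \<le> c * (\<Sum>i\<in>S. w i * (h i x / H i))"
      by (intro mult_left_mono weighted_arith_geom_mean) (use assms c pos in auto)
    finally show ?thesis .
  qed
  then have "(\<integral>\<^sup>+x. ennreal (\<Prod>i\<in>S. h i x powr w i) \<partial>M)
      \<le> (\<integral>\<^sup>+x. ennreal c * (\<Sum>i\<in>S. ennreal (w i / H i) * ennreal (h i x)) \<partial>M)"
  proof (intro nn_integral_mono)
    fix x
    have "ennreal (\<Prod>i\<in>S. h i x powr w i) \<le> ennreal (c * (\<Sum>i\<in>S. w i * (h i x / H i)))"
      by (intro ennreal_leI) fact
    also have "\<dots> = ennreal c * (\<Sum>i\<in>S. ennreal (w i / H i * h i x))"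
      using c h w pos
      by (subst ennreal_mult)
         (simp_all add: sum_nonneg divide_nonneg_pos sum_ennreal)
    also have "\<dots> = ennreal c * (\<Sum>i\<in>S. ennreal (w i / H i) * ennreal (h i x))"
      using h w pos
      by (intro arg_cong2[of _ _ _ _ "(*)"] sum.cong refl ennreal_mult) (auto intro!: divide_nonneg_pos)
    finally show "ennreal (\<Prod>i\<in>S. h i x powr w i) \<le> \<dots>" .
  qed
  also have "\<dots> = ennreal c * (\<Sum>i\<in>S. ennreal (w i / H i) * (\<integral>\<^sup>+x. ennreal (h i x) \<partial>M))"
    by (simp add: nn_integral_cmult nn_integral_sum)
  also have "\<dots> \<le> ennreal c * (\<Sum>i\<in>S. ennreal (w i / H i) * ennreal (H i))"
    by (intro mult_left_mono sum_mono H) auto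
  also have "\<dots> = ennreal c * (\<Sum>i\<in>S. ennreal (w i))"
    using pos w
    by (intro arg_cong2[of _ _ _ _ "(*)"] sum.cong refl)
       (auto simp: ennreal_mult[symmetric] less_imp_le intro!: arg_cong[of _ _ ennreal] dest!: pos)
  also have "\<dots> = ennreal c"
    using w by (subst sum_ennreal) auto
  finally show ?thesis
    by (simp add: c_def)
qed

lemma Holder_two:
  fixes u w :: "'b \<Rightarrow> real"
  assumes "integrable M u" "integrable M w" and nn: "\<And>x. u x \<ge> 0" "\<And>x. w x \<ge> 0"
    and \<theta>: "0 \<le> \<theta>" "\<theta> \<le> 1"
  shows "integrable M (\<lambda>x. u x powr (1 - \<theta>) * w x powr \<theta>)"
    and "(\<integral>x. u x powr (1 - \<theta>) * w x powr \<theta> \<partial>M)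
    \<le> (\<integral>x. u x \<partial>M) powr (1 - \<theta>) * (\<integral>x. w x \<partial>M) powr \<theta>"
proof -
  have [measurable]: "u \<in> borel_measurable M" "w \<in> borel_measurable M"
    using assms by auto
  define h where "h b = (if b then u else w)" for b
  define e where "e b = (if b then 1 - \<theta> else \<theta>)" for b
  have "(\<integral>\<^sup>+x. ennreal (\<Prod>b\<in>UNIV. h b x powr e b) \<partial>M) \<le> ennreal (\<Prod>b\<in>UNIV. (\<integral>x. h b x \<partial>M) powr e b)"
  proof (rule nn_integral_Holder)
    fix b :: bool
    have "integrable M (h b)" using assms by (simp add: h_def)
    moreover have "\<And>x. h b x \<ge> 0" using nn by (simp add: h_def)
    ultimately show "(\<integral>\<^sup>+x. ennreal (h b x) \<partial>M) \<le> ennreal (\<integral>x. h b x \<partial>M)"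
      by (subst nn_integral_eq_integral) auto
  qed (use nn \<theta> in \<open>auto simp: h_def e_def UNIV_bool\<close>)
  then have *: "(\<integral>\<^sup>+x. ennreal (u x powr (1 - \<theta>) * w x powr \<theta>) \<partial>M)
    \<le> ennreal ((\<integral>x. u x \<partial>M) powr (1 - \<theta>) * (\<integral>x. w x \<partial>M) powr \<theta>)"
    by (simp add: UNIV_bool h_def e_def mult.commute)
  then show "integrable M (\<lambda>x. u x powr (1 - \<theta>) * w x powr \<theta>)"
    by (intro integrableI_nonneg) (auto intro: le_less_trans)
  from * have "enn2real (\<integral>\<^sup>+x. ennreal (u x powr (1 - \<theta>) * w x powr \<theta>) \<partial>M)
    \<le> (\<integral>x. u x \<partial>M) powr (1 - \<theta>) * (\<integral>x. w x \<partial>M) powr \<theta>"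
    by (metis enn2real_ennreal enn2real_mono ennreal_less_top powr_ge_zero mult_nonneg_nonneg)
  then show "(\<integral>x. u x powr (1 - \<theta>) * w x powr \<theta> \<partial>M)
    \<le> (\<integral>x. u x \<partial>M) powr (1 - \<theta>) * (\<integral>x. w x \<partial>M) powr \<theta>"
    by (subst integral_eq_nn_integral) auto
qed

section \<open>The Gagliardo-Nirenberg inequality\<close>

text \<open>The partial integral of Fubini's theorem over the directions in J, kept as a function on
  the whole space so that the space need not be split into a product. It interpolates between g
  itself (J empty) and the full integral (J = \<open>Basis\<close>).\<close>

definition sliceint :: "'a::euclidean_space set \<Rightarrow> ('a \<Rightarrow> ennreal) \<Rightarrow> 'a \<Rightarrow> ennreal" where
  "sliceint J g x = (\<integral>\<^sup>+y. g (x + (\<Sum>b\<in>J. y b *\<^sub>R b)) \<partial>(\<Pi>\<^sub>M b\<in>J. lborel))"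

lemma sliceint_empty [simp]: "sliceint {} g x = g x"
  by (simp add: sliceint_def PiM_empty nn_integral_count_space_finite)

lemma sliceint_insert:
  fixes g :: "'a::euclidean_space \<Rightarrow> ennreal"
  assumes J: "finite J" "b \<notin> J" and [measurable]: "g \<in> borel_measurable borel"
  shows "sliceint (insert b J) g x = (\<integral>\<^sup>+t. sliceint J g (x + t *\<^sub>R b) \<partial>lborel)"
proof -
  interpret product_sigma_finite "\<lambda>_::'a. lborel :: real measure" by standard
  have "sliceint (insert b J) g x =
    (\<integral>\<^sup>+t. (\<integral>\<^sup>+y. g (x + (\<Sum>c\<in>insert b J. (y(b := t)) c *\<^sub>R c)) \<partial>(\<Pi>\<^sub>M b\<in>J. lborel)) \<partial>lborel)"
    unfolding sliceint_def by (rule product_nn_integral_insert_rev) (use J in measurable)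
  moreover have "(\<Sum>c\<in>insert b J. (y(b := t)) c *\<^sub>R c) = t *\<^sub>R b + (\<Sum>c\<in>J. y c *\<^sub>R c)" for y t
    using J by (auto intro!: sum.cong)
  ultimately show ?thesis
    by (simp only: sliceint_def add.assoc)
qed

lemma borel_measurable_sliceint [measurable]:
  fixes g :: "'a::euclidean_space \<Rightarrow> ennreal"
  assumes "finite J" and g [measurable]: "g \<in> borel_measurable borel"
  shows "sliceint J g \<in> borel_measurable borel"
  using \<open>finite J\<close>
proof induction
  case empty
  then show ?case by (simp add: sliceint_def PiM_empty nn_integral_count_space_finite)
next
  case (insert b J)
  note [measurable] = insert.IH
  have "(\<lambda>x. \<integral>\<^sup>+t. sliceint J g (x + t *\<^sub>R b) \<partial>lborel) \<in> borel_measurable borel"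
    by measurable
  then show ?case
    using sliceint_insert[OF insert.hyps g] by (simp cong: measurable_cong)
qed

text \<open>Translation invariance in the variable b, isolated as the outermost integral. This is
  what allows a factor to be pulled out of an integral in Gagliardo's induction.\<close>

lemma sliceint_shift:
  fixes g :: "'a::euclidean_space \<Rightarrow> ennreal"
  assumes J: "finite J" "b \<in> J" and g [measurable]: "g \<in> borel_measurable borel"
  shows "sliceint J g (x + t *\<^sub>R b) = sliceint J g x"
proof -
  define I where "I = J - {b}"
  have I: "finite I" "b \<notin> I" and JI: "J = insert b I"
    using J by (auto simp: I_def)
  note [measurable] = borel_measurable_sliceint[OF I(1) g]
  have "sliceint J g x = (\<integral>\<^sup>+u. sliceint I g (x + u *\<^sub>R b) \<partial>lborel)"
    unfolding JI by (rule sliceint_insert[OF I g])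
  also have "\<dots> = (\<integral>\<^sup>+u. sliceint I g (x + (t + u) *\<^sub>R b) \<partial>lborel)"
    by (subst nn_integral_real_affine[where c = 1 and t = t]) auto
  also have "\<dots> = sliceint J g (x + t *\<^sub>R b)"
    unfolding JI by (simp add: sliceint_insert[OF I g] algebra_simps)
  finally show ?thesis ..
qed

lemma sliceint_Basis:
  fixes g :: "'a::euclidean_space \<Rightarrow> ennreal"
  assumes [measurable]: "g \<in> borel_measurable borel"
  shows "sliceint Basis g 0 = (\<integral>\<^sup>+x. g x \<partial>lborel)"
  unfolding sliceint_def by (subst (2) lborel_eq) (simp add: nn_integral_distr)

text \<open>Gagliardo's inequality, by integrating one variable at a time: the factor that does not
  depend on the new variable is pulled out, and Hoelder's inequality with equal weights
  is applied to the remaining ones.\<close>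

lemma sliceint_prod_le:
  fixes g :: "'a::euclidean_space \<Rightarrow> ennreal"
  assumes dim: "DIM('a) \<ge> 2" and g [measurable]: "g \<in> borel_measurable borel"
    and fin: "\<And>J x. J \<subseteq> Basis \<Longrightarrow> sliceint J g x < \<infinity>"
    and "J \<subseteq> Basis"
  defines "\<Phi> \<equiv> \<lambda>J x. \<Prod>i\<in>Basis. enn2real (sliceint (insert i J) g x) powr (1 / (real DIM('a) - 1))"
  shows "sliceint J (\<lambda>x. ennreal (\<Phi> {} x)) x \<le> ennreal (\<Phi> J x)"
proof -
  have "finite J" using \<open>J \<subseteq> Basis\<close> finite_Basis finite_subset by blast
  then show ?thesis using \<open>J \<subseteq> Basis\<close>
  proof (induction arbitrary: x)
    case empty
    then show ?case by simp
  next
    case (insert k J)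
    define m where "m = real DIM('a) - 1"
    have m: "m > 0" using dim by (simp add: m_def)
    define G where "G J x = enn2real (sliceint J g x)" for J x
    have meas [measurable]: "G I \<in> borel_measurable borel" if "finite I" for I
      using borel_measurable_sliceint[OF that g] unfolding G_def[abs_def] by measurable
    have GT: "ennreal (G I x) = sliceint I g x" if "I \<subseteq> Basis" for I x
      using fin[OF that] by (simp add: G_def)
    have \<Phi>: "\<Phi> I x = (\<Prod>i\<in>Basis. G (insert i I) x powr (1 / m))" for I x
      by (simp add: \<Phi>_def G_def m_def)
    have k: "k \<in> Basis" and JB: "J \<subseteq> Basis"
      using insert.prems by auto
    have [measurable]: "\<Phi> {} \<in> borel_measurable borel"
      unfolding \<Phi>[abs_def] by measurable
    have "sliceint (insert k J) (\<lambda>x. ennreal (\<Phi> {} x)) x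
        = (\<integral>\<^sup>+t. sliceint J (\<lambda>x. ennreal (\<Phi> {} x)) (x + t *\<^sub>R k) \<partial>lborel)"
      by (rule sliceint_insert) (use insert.hyps in auto)
    also have "\<dots> \<le> (\<integral>\<^sup>+t. ennreal (\<Phi> J (x + t *\<^sub>R k)) \<partial>lborel)"
      by (intro nn_integral_mono insert.IH JB)
    also have "\<dots> = (\<integral>\<^sup>+t. ennreal (G (insert k J) x powr (1 / m)) *
        ennreal (\<Prod>i\<in>Basis - {k}. G (insert i J) (x + t *\<^sub>R k) powr (1 / m)) \<partial>lborel)"
    proof (intro nn_integral_cong)
      fix t :: real
      \<comment> \<open>For i = k the direction k is already integrated out, so this factor is
        constant in t.\<close>
      have "G (insert k J) (x + t *\<^sub>R k) = G (insert k J) x"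
        unfolding G_def using insert.hyps by (subst sliceint_shift) auto
      then show "ennreal (\<Phi> J (x + t *\<^sub>R k)) = ennreal (G (insert k J) x powr (1 / m)) *
        ennreal (\<Prod>i\<in>Basis - {k}. G (insert i J) (x + t *\<^sub>R k) powr (1 / m))"
        unfolding \<Phi> by (simp add: prod.remove[OF finite_Basis k] ennreal_mult prod_nonneg)
    qed
    also have "\<dots> = ennreal (G (insert k J) x powr (1 / m)) *
        (\<integral>\<^sup>+t. ennreal (\<Prod>i\<in>Basis - {k}. G (insert i J) (x + t *\<^sub>R k) powr (1 / m)) \<partial>lborel)"
      using insert.hyps by (intro nn_integral_cmult) measurable
    also have "\<dots> \<le> ennreal (G (insert k J) x powr (1 / m)) *
        ennreal (\<Prod>i\<in>Basis - {k}. G (insert i (insert k J)) x powr (1 / m))"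
    proof (intro mult_left_mono nn_integral_Holder)
      \<comment> \<open>n - 1 factors remain, each with weight 1/(n - 1): this is why the product is
        built with that exponent.\<close>
      show "(\<Sum>i\<in>Basis - {k}. 1 / m) = 1"
        using m k dim by (simp add: m_def card_Diff_singleton of_nat_diff)
      fix i assume i: "i \<in> Basis - {k}"
      show "(\<lambda>t. G (insert i J) (x + t *\<^sub>R k)) \<in> borel_measurable lborel"
        using measurable_compose[OF _ meas[of "insert i J"], of "\<lambda>t. x + t *\<^sub>R k" lborel] insert.hyps
        by simp
      have "(\<integral>\<^sup>+t. ennreal (G (insert i J) (x + t *\<^sub>R k)) \<partial>lborel)
          = (\<integral>\<^sup>+t. sliceint (insert i J) g (x + t *\<^sub>R k) \<partial>lborel)"
        by (intro nn_integral_cong GT) (use i JB in auto)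
      also have "\<dots> = sliceint (insert k (insert i J)) g x"
        by (rule sliceint_insert[symmetric]) (use i insert.hyps in auto)
      also have "\<dots> = ennreal (G (insert i (insert k J)) x)"
        by (subst GT) (use i k JB in \<open>auto simp: insert_commute\<close>)
      finally show "(\<integral>\<^sup>+t. ennreal (G (insert i J) (x + t *\<^sub>R k)) \<partial>lborel)
        \<le> ennreal (G (insert i (insert k J)) x)" by simp
    qed (use m in \<open>auto simp: G_def\<close>)
    also have "\<dots> = ennreal (\<Phi> (insert k J) x)"
      unfolding \<Phi> by (simp add: prod.remove[OF finite_Basis k] ennreal_mult prod_nonneg)
    finally show ?case .
  qed
qed

text \<open>No derivative occurs: f is dominated by a line integral of g in each of the n coordinate
  directions, and multiplying the n roots of order n - 1 gives the power n/(n - 1). Once all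
  variables are integrated, each of the n factors is the total integral of g. The assumption
  \<open>fin\<close> excludes infinite slices, which \<open>enn2real\<close> would turn into
  0.\<close>

lemma Gagliardo_Nirenberg:
  fixes f :: "'a::euclidean_space \<Rightarrow> real" and g :: "'a \<Rightarrow> ennreal"
  assumes dim: "DIM('a) \<ge> 2" and g [measurable]: "g \<in> borel_measurable borel"
    and fin: "\<And>J x. J \<subseteq> Basis \<Longrightarrow> sliceint J g x < \<infinity>"
    and f: "\<And>x. f x \<ge> 0" "\<And>x i. i \<in> Basis \<Longrightarrow> ennreal (f x) \<le> (\<integral>\<^sup>+t. g (x + t *\<^sub>R i) \<partial>lborel)"
  shows "(\<integral>\<^sup>+x. ennreal (f x powr (real DIM('a) / (real DIM('a) - 1))) \<partial>lborel)
    \<le> ennreal (enn2real (\<integral>\<^sup>+x. g x \<partial>lborel) powr (real DIM('a) / (real DIM('a) - 1)))"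
proof -
  define m where "m = real DIM('a) - 1"
  have m: "m > 0" using dim by (simp add: m_def)
  define \<Phi> where "\<Phi> J x = (\<Prod>i\<in>Basis. enn2real (sliceint (insert i J) g x) powr (1 / m))" for J and x :: 'a
  have pow: "(\<Prod>i\<in>(Basis::'a set). c powr (1 / m)) = c powr (real DIM('a) / m)" if "c \<ge> 0" for c
    by (cases "c = 0") (use that in \<open>auto simp: powr_powr simp flip: powr_realpow\<close>)
  have [measurable]: "\<Phi> {} \<in> borel_measurable borel"
    using borel_measurable_sliceint[OF _ g] unfolding \<Phi>_def[abs_def] by measurable
  have "f x powr (real DIM('a) / m) \<le> \<Phi> {} x" for x
  proof -
    have "f x \<le> enn2real (sliceint {i} g x)" if "i \<in> Basis" for i
    proof -
      have "ennreal (f x) \<le> sliceint {i} g x"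
        using f(2)[OF that, of x] by (simp add: sliceint_insert)
      then show ?thesis
        using fin[of "{i}" x] that
        by (metis empty_subsetI enn2real_ennreal enn2real_mono f(1) infinity_ennreal_def insert_subset)
    qed
    then have "(\<Prod>i\<in>(Basis::'a set). f x powr (1 / m)) \<le> \<Phi> {} x"
      unfolding \<Phi>_def using m f by (intro prod_mono) (auto intro!: powr_mono2)
    then show ?thesis by (simp only: pow[OF f(1)])
  qed
  then have "(\<integral>\<^sup>+x. ennreal (f x powr (real DIM('a) / m)) \<partial>lborel) \<le> (\<integral>\<^sup>+x. ennreal (\<Phi> {} x) \<partial>lborel)"
    by (intro nn_integral_mono ennreal_leI)
  also have "\<dots> = sliceint Basis (\<lambda>x. ennreal (\<Phi> {} x)) 0"
    by (subst sliceint_Basis) auto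
  also have "\<dots> \<le> ennreal (\<Phi> Basis 0)"
    unfolding \<Phi>_def m_def by (rule sliceint_prod_le[OF dim g fin]) auto
  also have "\<Phi> Basis 0 = (\<Prod>i\<in>(Basis::'a set). enn2real (\<integral>\<^sup>+x. g x \<partial>lborel) powr (1 / m))"
    unfolding \<Phi>_def by (intro prod.cong refl) (simp add: insert_absorb sliceint_Basis)
  also have "\<dots> = enn2real (\<integral>\<^sup>+x. g x \<partial>lborel) powr (real DIM('a) / m)"
    by (rule pow) simp
  finally show ?thesis by (simp add: m_def)
qed

text \<open>Supplies \<open>fin\<close> above. Moving in other basis directions leaves the k-th
  coordinate alone, so the integrand vanishes once that coordinate exceeds R in absolute value; each
  integrated direction therefore costs one factor 2R.\<close>

lemma sliceint_finite:
  fixes g :: "'a::euclidean_space \<Rightarrow> ennreal"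
  assumes g [measurable]: "g \<in> borel_measurable borel" and "R \<ge> 0" "M \<ge> 0"
    and le: "\<And>x. g x \<le> ennreal M" and supp: "\<And>x. norm x > R \<Longrightarrow> g x = 0"
    and "J \<subseteq> Basis"
  shows "sliceint J g x \<le> ennreal (M * (2 * R) ^ card J)"
proof -
  have "finite J" using \<open>J \<subseteq> Basis\<close> finite_Basis finite_subset by blast
  then show ?thesis using \<open>J \<subseteq> Basis\<close>
  proof (induction arbitrary: x)
    case empty
    then show ?case by (simp add: le)
  next
    case (insert k J)
    then have k: "k \<in> Basis" and JB: "J \<subseteq> Basis" by auto
    have inner: "(x + t *\<^sub>R k + (\<Sum>b\<in>J. y b *\<^sub>R b)) \<bullet> k = x \<bullet> k + t" for t and y :: "'a \<Rightarrow> real"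
    proof -
      have "(\<Sum>b\<in>J. y b *\<^sub>R b) \<bullet> k = (\<Sum>b\<in>J. y b * (b \<bullet> k))"
        by (simp add: inner_sum_left)
      also have "\<dots> = 0"
        using k JB insert.hyps
        by (intro sum.neutral ballI) (metis inner_not_same_Basis mult_zero_right subsetD)
      finally show ?thesis using k by (simp add: inner_add_left)
    qed
    have zero: "sliceint J g (x + t *\<^sub>R k) = 0" if "\<bar>x \<bullet> k + t\<bar> > R" for t
    proof -
      have "g (x + t *\<^sub>R k + (\<Sum>b\<in>J. y b *\<^sub>R b)) = 0" for y
        using Basis_le_norm[OF k, of "x + t *\<^sub>R k + (\<Sum>b\<in>J. y b *\<^sub>R b)"] that
        by (intro supp) (simp add: inner)
      then show ?thesis by (simp add: sliceint_def)
    qed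
    have "sliceint (insert k J) g x = (\<integral>\<^sup>+t. sliceint J g (x + t *\<^sub>R k) \<partial>lborel)"
      by (rule sliceint_insert) (use insert.hyps in auto)
    also have "\<dots> \<le> (\<integral>\<^sup>+t. ennreal (M * (2 * R) ^ card J) * indicator {- R - x \<bullet> k..R - x \<bullet> k} t \<partial>lborel)"
      using insert.IH[OF JB] zero by (intro nn_integral_mono) (force simp: indicator_def not_le)
    also have "\<dots> = ennreal (M * (2 * R) ^ card J) * ennreal (2 * R)"
      using \<open>R \<ge> 0\<close> by (subst nn_integral_cmult_indicator) auto
    also have "\<dots> = ennreal (M * (2 * R) ^ card (insert k J))"
      using \<open>R \<ge> 0\<close> \<open>M \<ge> 0\<close> insert.hyps by (simp add: ennreal_mult[symmetric] mult_ac)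
    finally show ?case .
  qed
qed

section \<open>Pointwise slopes\<close>

text \<open>A substitute for the norm of the gradient that also makes sense for the
  merely Lipschitz distance function.\<close>

definition slope_le :: "('a::metric_space \<Rightarrow> real) \<Rightarrow> 'a \<Rightarrow> real \<Rightarrow> bool" where
  "slope_le f x c \<longleftrightarrow> (\<forall>c'>c. \<forall>\<^sub>F y in nhds x. \<bar>f y - f x\<bar> \<le> c' * dist y x)"

lemma slope_leD: "slope_le f x c \<Longrightarrow> c < c' \<Longrightarrow> \<forall>\<^sub>F y in nhds x. \<bar>f y - f x\<bar> \<le> c' * dist y x"
  by (auto simp: slope_le_def)

lemma slope_le_cong:
  assumes "\<forall>\<^sub>F y in nhds x. f y = g y" and "slope_le g x c"
  shows "slope_le f x c"
  unfolding slope_le_def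
proof (intro allI impI)
  fix c' assume "c < c'"
  show "\<forall>\<^sub>F y in nhds x. \<bar>f y - f x\<bar> \<le> c' * dist y x"
    using assms(1) slope_leD[OF assms(2) \<open>c < c'\<close>]
  proof eventually_elim
    case (elim y)
    then show ?case using eventually_nhds_x_imp_x[OF assms(1)] by simp
  qed
qed

lemma slope_le_lipschitz:
  assumes "\<And>y. \<bar>f y - f x\<bar> \<le> L * dist y x"
  shows "slope_le f x L"
  unfolding slope_le_def
  by (auto intro!: always_eventually order_trans[OF assms] mult_right_mono)

lemma slope_le_imp_tendsto:
  assumes "slope_le f x c"
  shows "(f \<longlongrightarrow> f x) (nhds x)"
proof -
  have "\<forall>\<^sub>F y in nhds x. norm (f y - f x) \<le> (c + 1) * dist y x"
    using slope_leD[OF assms, of "c + 1"] by simp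
  moreover have "((\<lambda>y. (c + 1) * dist y x) \<longlongrightarrow> 0) (nhds x)"
    by (auto intro!: tendsto_eq_intros filterlim_ident)
  ultimately have "((\<lambda>y. f y - f x) \<longlongrightarrow> 0) (nhds x)"
    by (rule Lim_null_comparison)
  then show ?thesis
    using LIM_zero_iff by blast
qed

lemma slope_le_mult:
  assumes f: "slope_le f x c1" and g: "slope_le g x c2" and "c1 \<ge> 0" "c2 \<ge> 0"
  shows "slope_le (\<lambda>y. f y * g y) x (\<bar>f x\<bar> * c2 + \<bar>g x\<bar> * c1)"
  unfolding slope_le_def
proof (intro allI impI)
  fix c' assume c': "\<bar>f x\<bar> * c2 + \<bar>g x\<bar> * c1 < c'"
  \<comment> \<open>All bounds are loosened by the same e; the loosened product rule tends to the
    exact one as e decreases to 0, so some e > 0 stays below c'.\<close>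
  have "((\<lambda>e. (\<bar>f x\<bar> + e) * (c2 + e) + \<bar>g x\<bar> * (c1 + e)) \<longlongrightarrow> \<bar>f x\<bar> * c2 + \<bar>g x\<bar> * c1) (at_right 0)"
    by (auto intro!: tendsto_eq_intros)
  from order_tendstoD(2)[OF this c'] eventually_at_right_less[of "0::real"]
  have "\<forall>\<^sub>F e in at_right 0. 0 < e \<and> (\<bar>f x\<bar> + e) * (c2 + e) + \<bar>g x\<bar> * (c1 + e) < c'"
    by eventually_elim auto
  then obtain e where e: "e > 0" "(\<bar>f x\<bar> + e) * (c2 + e) + \<bar>g x\<bar> * (c1 + e) < c'"
    using eventually_happens' trivial_limit_at_right_real by blast
  have "\<forall>\<^sub>F y in nhds x. \<bar>f y\<bar> < \<bar>f x\<bar> + e"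
    using e by (intro order_tendstoD(2)[OF tendsto_rabs[OF slope_le_imp_tendsto[OF f]]]) simp
  moreover have "\<forall>\<^sub>F y in nhds x. \<bar>f y - f x\<bar> \<le> (c1 + e) * dist y x"
    using slope_leD[OF f, of "c1 + e"] e by simp
  moreover have "\<forall>\<^sub>F y in nhds x. \<bar>g y - g x\<bar> \<le> (c2 + e) * dist y x"
    using slope_leD[OF g, of "c2 + e"] e by simp
  ultimately show "\<forall>\<^sub>F y in nhds x. \<bar>f y * g y - f x * g x\<bar> \<le> c' * dist y x"
  proof eventually_elim
    case (elim y)
    have "f y * g y - f x * g x = f y * (g y - g x) + g x * (f y - f x)"
      by (simp add: algebra_simps)
    then have "\<bar>f y * g y - f x * g x\<bar> \<le> \<bar>f y\<bar> * \<bar>g y - g x\<bar> + \<bar>g x\<bar> * \<bar>f y - f x\<bar>"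
      by (metis abs_mult abs_triangle_ineq)
    also have "\<dots> \<le> (\<bar>f x\<bar> + e) * ((c2 + e) * dist y x) + \<bar>g x\<bar> * ((c1 + e) * dist y x)"
      using elim e assms by (intro add_mono mult_mono) auto
    also have "\<dots> = ((\<bar>f x\<bar> + e) * (c2 + e) + \<bar>g x\<bar> * (c1 + e)) * dist y x"
      by (simp add: algebra_simps)
    also have "\<dots> \<le> c' * dist y x"
      using e by (intro mult_right_mono) auto
    finally show ?case .
  qed
qed

text \<open>The bound k concerns h only near \<open>f x\<close>; continuity of f at x, itself a
  consequence of its slope bound, pulls that neighbourhood back.\<close>

lemma slope_le_compose:
  assumes f: "slope_le f x c" and h: "slope_le h (f x) k" and "c \<ge> 0" "k \<ge> 0"
  shows "slope_le (\<lambda>y. h (f y)) x (k * c)"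
  unfolding slope_le_def
proof (intro allI impI)
  fix c' assume c': "k * c < c'"
  have "((\<lambda>e. (k + e) * (c + e)) \<longlongrightarrow> k * c) (at_right 0)"
    by (auto intro!: tendsto_eq_intros)
  from order_tendstoD(2)[OF this c'] eventually_at_right_less[of "0::real"]
  have "\<forall>\<^sub>F e in at_right 0. 0 < e \<and> (k + e) * (c + e) < c'"
    by eventually_elim auto
  then obtain e where e: "e > 0" "(k + e) * (c + e) < c'"
    using eventually_happens' trivial_limit_at_right_real by blast
  have "\<forall>\<^sub>F y in nhds x. \<bar>h (f y) - h (f x)\<bar> \<le> (k + e) * dist (f y) (f x)"
    using e by (intro eventually_compose_filterlim[OF slope_leD[OF h] slope_le_imp_tendsto[OF f]]) simp
  moreover have "\<forall>\<^sub>F y in nhds x. \<bar>f y - f x\<bar> \<le> (c + e) * dist y x"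
    using slope_leD[OF f, of "c + e"] e by simp
  ultimately show "\<forall>\<^sub>F y in nhds x. \<bar>h (f y) - h (f x)\<bar> \<le> c' * dist y x"
  proof eventually_elim
    case (elim y)
    have "\<bar>h (f y) - h (f x)\<bar> \<le> (k + e) * ((c + e) * dist y x)"
      using elim e assms
      by (intro order_trans[OF elim(1)] mult_left_mono) (auto simp: dist_real_def)
    also have "\<dots> \<le> c' * dist y x"
      using e unfolding mult.assoc[symmetric] by (intro mult_right_mono) auto
    finally show ?case .
  qed
qed

lemma slope_le_has_derivative:
  fixes f :: "'a::real_normed_vector \<Rightarrow> real"
  assumes D: "(f has_derivative D) (at x)" and c: "\<And>h. \<bar>D h\<bar> \<le> c * norm h"
  shows "slope_le f x c"
  unfolding slope_le_def
proof (intro allI impI)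
  fix c' assume "c < c'"
  then obtain \<delta> where "\<delta> > 0" and \<delta>: "\<And>y. norm (y - x) < \<delta> \<Longrightarrow>
      norm (f y - f x - D (y - x)) \<le> (c' - c) * norm (y - x)"
    using D unfolding has_derivative_at_alt by (metis diff_gt_0_iff_gt)
  have "\<bar>f y - f x\<bar> \<le> c' * dist y x" if "dist y x < \<delta>" for y
    using \<delta>[of y] c[of "y - x"] that by (simp add: dist_norm algebra_simps)
  then show "\<forall>\<^sub>F y in nhds x. \<bar>f y - f x\<bar> \<le> c' * dist y x"
    using \<open>\<delta> > 0\<close> by (auto simp: eventually_nhds_metric)
qed

lemma slope_le_DERIV:
  fixes f :: "real \<Rightarrow> real"
  assumes "(f has_real_derivative D) (at x)"
  shows "slope_le f x \<bar>D\<bar>"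
  by (rule slope_le_has_derivative[OF assms[unfolded has_field_derivative_def]])
     (simp add: abs_mult)

lemma slope_le_powr:
  fixes a r :: real
  assumes "r > 0" "a \<ge> 0"
  shows "slope_le (\<lambda>r. r powr a) r (a * r powr (a - 1))"
  using slope_le_DERIV[OF has_real_derivative_powr[OF assms(1), of a]] assms by simp

text \<open>For exponent 0 the convention here is 1, also at the origin, unlike for powr.\<close>

definition cpowr :: "real \<Rightarrow> real \<Rightarrow> real" where
  "cpowr r e = (if e = 0 then 1 else r powr e)"

lemma cpowr_nonneg [simp]: "cpowr r e \<ge> 0"
  by (simp add: cpowr_def)

lemma continuous_on_cpowr [continuous_intros]:
  fixes f :: "'a::topological_space \<Rightarrow> real"
  assumes "continuous_on S f" "\<And>x. x \<in> S \<Longrightarrow> f x \<ge> 0" "e \<ge> 0"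
  shows "continuous_on S (\<lambda>x. cpowr (f x) e)"
  using assms by (cases "e = 0") (auto simp: cpowr_def intro!: continuous_on_powr')

text \<open>For s = 1 the slope at the origin is 1, which is why \<open>cpowr\<close> is used in the
  bound. For s > 1 it is 0 there, since |y|^s = |y|^(s-1) |y| and the first factor tends to
  0.\<close>

lemma slope_le_abs_powr:
  assumes "s \<ge> 1"
  shows "slope_le (\<lambda>u. \<bar>u\<bar> powr s) u (s * cpowr \<bar>u\<bar> (s - 1))"
proof (cases "s = 1")
  case True
  then show ?thesis
    by (auto simp: cpowr_def dist_real_def intro!: slope_le_lipschitz)
next
  case s: False
  show ?thesis
  proof (cases "u = 0")
    case False
    have "slope_le abs u 1"
      by (intro slope_le_lipschitz) (simp add: dist_real_def)
    from slope_le_compose[OF this slope_le_powr[of "\<bar>u\<bar>" s]] show ?thesis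
      using False s assms by (simp add: cpowr_def)
  next
    case True
    have "((\<lambda>y::real. \<bar>y\<bar> powr (s - 1)) \<longlongrightarrow> 0) (nhds 0)"
      using s assms by (auto intro!: tendsto_eq_intros filterlim_ident)
    then have *: "\<forall>\<^sub>F y in nhds 0. \<bar>y::real\<bar> powr (s - 1) < c'" if "c' > 0" for c'
      using order_tendstoD(2) that by blast
    show ?thesis
      unfolding slope_le_def
    proof (intro allI impI)
      fix c' assume "s * cpowr \<bar>u\<bar> (s - 1) < c'"
      then have "c' > 0" using True s by (simp add: cpowr_def)
      from *[OF this] show "\<forall>\<^sub>F y in nhds u. \<bar>\<bar>y\<bar> powr s - \<bar>u\<bar> powr s\<bar> \<le> c' * dist y u"
        unfolding True
      proof eventually_elim
        case (elim y)
        have "\<bar>y\<bar> powr s = \<bar>y\<bar> powr (s - 1) * \<bar>y\<bar>"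
          by (cases "y = 0") (auto simp: powr_diff)
        then show ?case
          using mult_right_mono[OF less_imp_le[OF elim], of "\<bar>y\<bar>"] by (simp add: dist_real_def)
      qed
    qed
  qed
qed

text \<open>Half of a fundamental theorem of calculus without differentiability. With an error
  proportional to the length of the interval the bound is additive under concatenation, and it holds
  on short intervals around every point, so a bisection argument (\<open>Bolzano\<close>) makes it
  global; the error then tends to 0.\<close>

lemma slope_le_integral_bound:
  fixes \<phi> \<psi> :: "real \<Rightarrow> real"
  assumes "\<alpha> \<le> \<beta>" and cont: "continuous_on UNIV \<psi>" and slope: "\<And>t. slope_le \<phi> t (\<psi> t)"
  shows "\<bar>\<phi> \<beta> - \<phi> \<alpha>\<bar> \<le> integral {\<alpha>..\<beta>} \<psi>"
proof -
  have int: "\<psi> integrable_on {u..w}" for u w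
    by (intro integrable_continuous_real continuous_on_subset[OF cont]) auto
  have "\<bar>\<phi> \<beta> - \<phi> \<alpha>\<bar> \<le> integral {\<alpha>..\<beta>} \<psi> + \<epsilon> * (\<beta> - \<alpha>)" if "\<epsilon> > 0" for \<epsilon>
    using \<open>\<alpha> \<le> \<beta>\<close>
  proof (induction rule: Bolzano)
    case (trans a b c)
    have "integral {a..b} \<psi> + integral {b..c} \<psi> = integral {a..c} \<psi>"
      using trans int by (intro Henstock_Kurzweil_Integration.integral_combine) auto
    with trans show ?case
      by (simp add: algebra_simps)
  next
    case (local x)
    have "\<forall>\<^sub>F t in nhds x. \<bar>\<phi> t - \<phi> x\<bar> \<le> (\<psi> x + \<epsilon> / 2) * dist t x"
      using that by (intro slope_leD[OF slope]) auto
    moreover have "(\<psi> \<longlongrightarrow> \<psi> x) (nhds x)"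
      using cont by (simp add: continuous_on_eq_continuous_at isCont_def tendsto_at_iff_tendsto_nhds)
    then have "\<forall>\<^sub>F t in nhds x. \<psi> x - \<epsilon> / 2 < \<psi> t"
      using that by (intro order_tendstoD(1)) auto
    ultimately have "\<forall>\<^sub>F t in nhds x. \<bar>\<phi> t - \<phi> x\<bar> \<le> (\<psi> x + \<epsilon> / 2) * dist t x \<and> \<psi> x - \<epsilon> / 2 < \<psi> t"
      by eventually_elim auto
    then obtain \<delta> where "\<delta> > 0" and \<delta>: "\<And>t. dist t x < \<delta> \<Longrightarrow>
        \<bar>\<phi> t - \<phi> x\<bar> \<le> (\<psi> x + \<epsilon> / 2) * dist t x \<and> \<psi> x - \<epsilon> / 2 < \<psi> t"
      unfolding eventually_nhds_metric by blast
    \<comment> \<open>The point x splits the interval, so the two slope bounds add up to a multiple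
      of w - u. Half of \<epsilon> pays for the slope, the other half for replacing \<psi> x by the
      integral of \<psi>.\<close>
    have "\<bar>\<phi> w - \<phi> u\<bar> \<le> integral {u..w} \<psi> + \<epsilon> * (w - u)" if "u \<le> x" "x \<le> w" "w - u < \<delta>" for u w
    proof -
      have "\<bar>\<phi> w - \<phi> u\<bar> \<le> \<bar>\<phi> w - \<phi> x\<bar> + \<bar>\<phi> u - \<phi> x\<bar>" by simp
      also have "\<dots> \<le> (\<psi> x + \<epsilon> / 2) * dist w x + (\<psi> x + \<epsilon> / 2) * dist u x"
        using \<delta>[of w] \<delta>[of u] that by (intro add_mono) (auto simp: dist_real_def)
      also have "\<dots> = (\<psi> x + \<epsilon> / 2) * (w - u)"
        using that by (simp add: dist_real_def flip: distrib_left)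
      finally have 1: "\<bar>\<phi> w - \<phi> u\<bar> \<le> (\<psi> x + \<epsilon> / 2) * (w - u)" .
      have "integral {u..w} (\<lambda>_. \<psi> x - \<epsilon> / 2) \<le> integral {u..w} \<psi>"
        using \<delta> that by (intro integral_le int) (auto simp: dist_real_def less_imp_le)
      then have "(\<psi> x - \<epsilon> / 2) * (w - u) \<le> integral {u..w} \<psi>"
        using that by (simp add: mult.commute)
      with 1 show ?thesis by (simp add: algebra_simps) argo
    qed
    then show ?case
      using \<open>\<delta> > 0\<close> by blast
  qed
  note * = this
  show ?thesis
  proof (cases "\<alpha> = \<beta>")
    case False
    then have "\<beta> - \<alpha> > 0" using \<open>\<alpha> \<le> \<beta>\<close> by simp
    show ?thesis
    proof (rule field_le_epsilon)
      fix e :: real assume "e > 0"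
      then show "\<bar>\<phi> \<beta> - \<phi> \<alpha>\<bar> \<le> integral {\<alpha>..\<beta>} \<psi> + e"
        using *[of "e / (\<beta> - \<alpha>)"] \<open>\<beta> - \<alpha> > 0\<close> by simp
    qed
  qed auto
qed

lemma slope_le_line_integral:
  fixes f g :: "'a::euclidean_space \<Rightarrow> real"
  assumes cont: "continuous_on UNIV g" and g: "\<And>x. g x \<ge> 0" and slope: "\<And>x. slope_le f x (g x)"
    and supp: "\<And>x. norm x > R \<Longrightarrow> f x = 0" and "R \<ge> 0" and e: "norm e = 1"
  shows "ennreal (f x) \<le> (\<integral>\<^sup>+t. ennreal (g (x + t *\<^sub>R e)) \<partial>lborel)"
proof -
  \<comment> \<open>Far enough back along the line to leave the support: x - T e has norm at least T
    - |x| = R + 1.\<close>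
  define T where "T = norm x + R + 1"
  have "T \<ge> 0" using \<open>R \<ge> 0\<close> by (simp add: T_def)
  define \<psi> where "\<psi> t = g (x + t *\<^sub>R e)" for t
  have \<psi>: "continuous_on UNIV \<psi>"
    unfolding \<psi>_def by (intro continuous_on_compose2[OF cont] continuous_intros) auto
  have [measurable]: "\<psi> \<in> borel_measurable borel"
    using \<psi> by (rule borel_measurable_continuous_onI)
  have sl: "slope_le (\<lambda>t. f (x + t *\<^sub>R e)) t (\<psi> t)" for t
    unfolding slope_le_def
  proof (intro allI impI)
    fix c' assume "\<psi> t < c'"
    then have "\<forall>\<^sub>F y in nhds (x + t *\<^sub>R e). \<bar>f y - f (x + t *\<^sub>R e)\<bar> \<le> c' * dist y (x + t *\<^sub>R e)"
      using slope by (intro slope_leD) (auto simp: \<psi>_def)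
    moreover have "filterlim (\<lambda>s. x + s *\<^sub>R e) (nhds (x + t *\<^sub>R e)) (nhds t)"
      by (intro tendsto_intros filterlim_ident)
    ultimately have "\<forall>\<^sub>F s in nhds t. \<bar>f (x + s *\<^sub>R e) - f (x + t *\<^sub>R e)\<bar> \<le> c' * dist (x + s *\<^sub>R e) (x + t *\<^sub>R e)"
      unfolding filterlim_iff by blast
    moreover have "dist (x + s *\<^sub>R e) (x + t *\<^sub>R e) = dist s t" for s
      using e by (simp add: dist_norm scaleR_diff_left[symmetric])
    ultimately show "\<forall>\<^sub>F s in nhds t. \<bar>f (x + s *\<^sub>R e) - f (x + t *\<^sub>R e)\<bar> \<le> c' * dist s t"
      by simp
  qed
  have int: "set_integrable lborel {- T..0} \<psi>"
    unfolding set_integrable_def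
    by (intro borel_integrable_compact continuous_on_subset[OF \<psi>]) auto
  have "\<bar>f (x + 0 *\<^sub>R e) - f (x + (- T) *\<^sub>R e)\<bar> \<le> integral {- T..0} \<psi>"
    using \<open>T \<ge> 0\<close> by (intro slope_le_integral_bound[OF _ \<psi> sl]) auto
  moreover have "norm (x + (- T) *\<^sub>R e) > R"
  proof -
    have "T - norm x \<le> norm (T *\<^sub>R e - x)"
      using norm_triangle_ineq2[of "T *\<^sub>R e" x] e \<open>T \<ge> 0\<close> by simp
    also have "\<dots> = norm (x + (- T) *\<^sub>R e)"
      by (simp add: norm_minus_commute)
    finally show ?thesis by (simp add: T_def)
  qed
  ultimately have "f x \<le> integral {- T..0} \<psi>"
    using supp by simp
  also have "\<dots> = (LINT t:{- T..0}|lborel. \<psi> t)"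
    by (rule set_borel_integral_eq_integral(2)[OF int, symmetric])
  finally have "ennreal (f x) \<le> ennreal (LINT t:{- T..0}|lborel. \<psi> t)"
    by (rule ennreal_leI)
  also have "\<dots> = (\<integral>\<^sup>+t. ennreal (indicator {- T..0} t *\<^sub>R \<psi> t) \<partial>lborel)"
    unfolding set_lebesgue_integral_def
    by (rule nn_integral_eq_integral[OF int[unfolded set_integrable_def], symmetric])
       (simp add: \<psi>_def g)
  also have "\<dots> \<le> (\<integral>\<^sup>+t. ennreal (\<psi> t) \<partial>lborel)"
    by (intro nn_integral_mono ennreal_leI) (auto simp: indicator_def \<psi>_def g)
  finally show ?thesis by (simp add: \<psi>_def)
qed

lemma integrable_continuous_support:
  fixes h :: "'a::euclidean_space \<Rightarrow> real"
  assumes "continuous_on UNIV h" "compact K" "\<And>x. x \<notin> K \<Longrightarrow> h x = 0"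
  shows "integrable lborel h"
proof -
  have "integrable lborel (\<lambda>x. indicator K x *\<^sub>R h x)"
    using assms by (intro borel_integrable_compact continuous_on_subset[OF assms(1)]) auto
  moreover have "(\<lambda>x. indicator K x *\<^sub>R h x) = h"
    using assms(3) by (force simp: indicator_def)
  ultimately show ?thesis by simp
qed

text \<open>The L^1 Sobolev inequality with constant 1, with a continuous upper slope g in the role
  of |grad f|. Compact support of g yields the finite slices, that of f the line-integral bounds
  along the unit basis vectors.\<close>

theorem Sobolev_slope:
  fixes f g :: "'a::euclidean_space \<Rightarrow> real"
  assumes dim: "DIM('a) \<ge> 2"
    and f: "\<And>x. f x \<ge> 0" and cont: "continuous_on UNIV g" and g: "\<And>x. g x \<ge> 0"
    and slope: "\<And>x. slope_le f x (g x)"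
    and K: "compact K" "\<And>x. x \<notin> K \<Longrightarrow> f x = 0" "\<And>x. x \<notin> K \<Longrightarrow> g x = 0"
  shows "(\<integral>x. f x powr (real DIM('a) / (real DIM('a) - 1)) \<partial>lborel)
    \<le> (\<integral>x. g x \<partial>lborel) powr (real DIM('a) / (real DIM('a) - 1))"
proof -
  let ?r = "real DIM('a) / (real DIM('a) - 1)"
  obtain R where R: "R > 0" "\<And>x. x \<in> K \<Longrightarrow> norm x \<le> R"
    using compact_imp_bounded[OF K(1)] unfolding bounded_pos by blast
  have "bounded (g ` K)"
    by (intro compact_imp_bounded compact_continuous_image continuous_on_subset[OF cont] K) auto
  then obtain M where M: "M > 0" "\<And>x. x \<in> K \<Longrightarrow> g x \<le> M"
    unfolding bounded_pos by force
  have gM: "g x \<le> M" for x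
    using M K(3)[of x] by (cases "x \<in> K") auto
  have supp: "x \<notin> K" if "norm x > R" for x
    using R(2)[of x] that by auto
  have [measurable]: "g \<in> borel_measurable borel"
    using cont by (rule borel_measurable_continuous_onI)
  have contf: "continuous_on UNIV f"
    using slope_le_imp_tendsto[OF slope]
    by (simp add: continuous_on_eq_continuous_at isCont_def tendsto_at_iff_tendsto_nhds)
  then have [measurable]: "f \<in> borel_measurable borel"
    by (rule borel_measurable_continuous_onI)
  have intg: "(\<integral>\<^sup>+x. ennreal (g x) \<partial>lborel) = ennreal (\<integral>x. g x \<partial>lborel)"
    using g by (intro nn_integral_eq_integral integrable_continuous_support[OF cont K(1,3)]) auto
  have "(\<integral>\<^sup>+x. ennreal (f x powr ?r) \<partial>lborel)
      \<le> ennreal (enn2real (\<integral>\<^sup>+x. ennreal (g x) \<partial>lborel) powr ?r)"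
  proof (rule Gagliardo_Nirenberg[OF dim])
    fix J :: "'a set" and x assume "J \<subseteq> Basis"
    then have "sliceint J (\<lambda>x. ennreal (g x)) x \<le> ennreal (M * (2 * R) ^ card J)"
      using R M gM supp K(3) by (intro sliceint_finite) (auto intro: ennreal_leI)
    then show "sliceint J (\<lambda>x. ennreal (g x)) x < \<infinity>"
      using ennreal_less_top le_less_trans by (metis infinity_ennreal_def)
  next
    fix x i :: 'a assume "i \<in> Basis"
    then show "ennreal (f x) \<le> (\<integral>\<^sup>+t. ennreal (g (x + t *\<^sub>R i)) \<partial>lborel)"
      using R K supp by (intro slope_le_line_integral[OF cont g slope, of R]) auto
  qed (auto simp: f)
  also have "\<dots> = ennreal ((\<integral>x. g x \<partial>lborel) powr ?r)"
    by (simp add: intg g)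
  finally have "(\<integral>\<^sup>+x. ennreal (f x powr ?r) \<partial>lborel) \<le> ennreal ((\<integral>x. g x \<partial>lborel) powr ?r)" .
  then have "enn2real (\<integral>\<^sup>+x. ennreal (f x powr ?r) \<partial>lborel) \<le> (\<integral>x. g x \<partial>lborel) powr ?r"
    by (metis enn2real_ennreal enn2real_mono ennreal_less_top powr_ge_zero)
  moreover have "(\<integral>x. f x powr ?r \<partial>lborel) = enn2real (\<integral>\<^sup>+x. ennreal (f x powr ?r) \<partial>lborel)"
    by (intro integral_eq_nn_integral) auto
  ultimately show ?thesis by simp
qed

section \<open>The anisotropic distance\<close>

text \<open>c and C are the minimum and maximum of F on the Euclidean unit sphere; homogeneity
  carries the bounds to all x.\<close>

lemma norm_equivalence:
  fixes F :: "'a::euclidean_space \<Rightarrow> real"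
  assumes "strictly_convex_C1_norm F"
  obtains c C where "c > 0" "C > 0" "\<And>x. c * norm x \<le> F x" "\<And>x. F x \<le> C * norm x"
proof -
  have cont: "continuous_on UNIV F" and pos: "\<And>x. x \<noteq> 0 \<Longrightarrow> F x > 0"
    and hom: "\<And>t x. t > 0 \<Longrightarrow> F (t *\<^sub>R x) = t * F x"
    using assms unfolding strictly_convex_C1_norm_def by (auto intro: convex_on_continuous)
  \<comment> \<open>Homogeneity is available only for positive factors, so the value at 0 comes from
    F 0 = 2 F 0.\<close>
  have F0: "F 0 = 0"
    using hom[of 2 0] by simp
  have cs: "continuous_on (sphere 0 1) F"
    using cont continuous_on_subset by blast
  have ne: "sphere (0::'a) 1 \<noteq> {}" by simp
  obtain u where u: "u \<in> sphere 0 1" "\<And>y. y \<in> sphere 0 1 \<Longrightarrow> F u \<le> F y"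
    using continuous_attains_inf[OF compact_sphere ne cs] by blast
  obtain w where w: "w \<in> sphere 0 1" "\<And>y. y \<in> sphere 0 1 \<Longrightarrow> F y \<le> F w"
    using continuous_attains_sup[OF compact_sphere ne cs] by blast
  have "F u * norm x \<le> F x \<and> F x \<le> F w * norm x" for x
  proof (cases "x = 0")
    case False
    define y where "y = x /\<^sub>R norm x"
    have y: "y \<in> sphere 0 1" and xy: "x = norm x *\<^sub>R y"
      using False by (auto simp: y_def)
    have "F x = norm x * F y"
      using hom[of "norm x" y] False xy by auto
    then show ?thesis
      using u(2)[OF y] w(2)[OF y] False by (simp add: mult.commute)
  qed (simp add: F0)
  moreover have "F u > 0" "F w > 0"
    using u(1) w(1) by (auto intro!: pos)
  ultimately show ?thesis
    using that by blast
qed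

text \<open>Cauchy-Schwarz. It bounds the set under the supremum in \<open>polar\<close>, without
  which a real-valued \<open>SUP\<close> has no usable upper-bound property.\<close>

lemma polar_bdd:
  fixes F :: "'a::euclidean_space \<Rightarrow> real"
  assumes "c > 0" "\<And>x. c * norm x \<le> F x" "\<xi> \<noteq> 0"
  shows "(\<xi> \<bullet> \<eta>) / F \<xi> \<le> norm \<eta> / c"
proof -
  have "F \<xi> > 0"
    using assms by (meson less_le_trans mult_pos_pos zero_less_norm_iff)
  moreover have "c * (\<xi> \<bullet> \<eta>) \<le> c * (norm \<xi> * norm \<eta>)"
    using assms(1) by (simp add: norm_cauchy_schwarz)
  then have "c * (\<xi> \<bullet> \<eta>) \<le> F \<xi> * norm \<eta>"
    using mult_right_mono[OF assms(2), of "norm \<eta>" \<xi>] by (simp add: mult_ac)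
  ultimately show ?thesis
    using assms(1) by (simp add: field_simps)
qed

lemma polar_ge:
  fixes F :: "'a::euclidean_space \<Rightarrow> real"
  assumes "c > 0" "\<And>x. c * norm x \<le> F x" "\<xi> \<noteq> 0"
  shows "(\<xi> \<bullet> \<eta>) / F \<xi> \<le> polar F \<eta>"
  unfolding polar_def using polar_bdd[of c F, OF assms(1,2)] assms(3)
  by (intro cSUP_upper bdd_aboveI2[where M = "norm \<eta> / c"]) auto

lemma polar_leI:
  fixes F :: "'a::euclidean_space \<Rightarrow> real"
  assumes "\<And>\<xi>. \<xi> \<noteq> 0 \<Longrightarrow> (\<xi> \<bullet> \<eta>) / F \<xi> \<le> M"
  shows "polar F \<eta> \<le> M"
proof -
  have "UNIV - {0::'a} \<noteq> {}"
    using nonempty_Basis nonzero_Basis by blast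
  then show ?thesis
    unfolding polar_def using assms by (intro cSUP_least) auto
qed

text \<open>Subadditivity of the supremum, with the second summand already estimated by the
  Euclidean norm: the form from which the Lipschitz constant 1/c of the distance is read
  off.\<close>

lemma polar_triangle:
  fixes F :: "'a::euclidean_space \<Rightarrow> real"
  assumes "c > 0" "\<And>x. c * norm x \<le> F x"
  shows "polar F (x + y) \<le> polar F x + norm y / c"
  using polar_ge[of c F _ x, OF assms] polar_bdd[of c F _ y, OF assms]
  by (intro polar_leI) (simp add: inner_add_right add_divide_distrib add_mono)

text \<open>The supremum is tested with x itself. The bound gives positivity of the distance inside
  the domain.\<close>

lemma polar_ge_norm:
  fixes F :: "'a::euclidean_space \<Rightarrow> real"
  assumes "c > 0" "\<And>x. c * norm x \<le> F x" "C > 0" "\<And>x. F x \<le> C * norm x"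
  shows "norm x / C \<le> polar F x"
proof (cases "x = 0")
  case True
  obtain \<xi> :: 'a where "\<xi> \<noteq> 0"
    using nonempty_Basis nonzero_Basis by blast
  from polar_ge[of c F, OF assms(1,2) this, of x] True show ?thesis by simp
next
  case False
  then have "F x > 0"
    using assms by (meson less_le_trans mult_pos_pos zero_less_norm_iff)
  then have "norm x / C \<le> (x \<bullet> x) / F x"
    using assms(3) mult_left_mono[OF assms(4)[of x], of "norm x"] False
    by (simp add: field_simps dot_square_norm power2_eq_square)
  with polar_ge[of c F, OF assms(1,2) False, of x] show ?thesis by linarith
qed

text \<open>An infimum of functions that share the Lipschitz constant 1/c. That constant depends on
  F alone, which makes the final constant independent of the domain.\<close>

lemma dF_lipschitz:
  fixes F :: "'a::euclidean_space \<Rightarrow> real"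
  assumes c: "c > 0" "\<And>x. c * norm x \<le> F x" and C: "C > 0" "\<And>x. F x \<le> C * norm x"
    and ne: "frontier \<Omega> \<noteq> {}"
  shows "\<bar>dF F \<Omega> x - dF F \<Omega> y\<bar> \<le> 1 / c * dist x y"
proof -
  have "polar F z \<ge> 0" for z
    using polar_ge_norm[of c F C z, OF c C] divide_nonneg_pos[OF norm_ge_zero C(1), of z] by linarith
  then have bdd: "bdd_below ((\<lambda>z. polar F (x - z)) ` frontier \<Omega>)" for x
    by (intro bdd_belowI2[where m = 0]) auto
  have "dF F \<Omega> x - norm (x - y) / c \<le> dF F \<Omega> y" for x y
    unfolding dF_def
  proof (rule cINF_greatest[OF ne])
    fix z assume "z \<in> frontier \<Omega>"
    then have "(INF z\<in>frontier \<Omega>. polar F (x - z)) \<le> polar F (x - z)"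
      by (intro cINF_lower bdd)
    also have "\<dots> \<le> polar F (y - z) + norm (x - y) / c"
      using polar_triangle[of c F "y - z" "x - y", OF c] by simp
    finally show "(INF z\<in>frontier \<Omega>. polar F (x - z)) - norm (x - y) / c \<le> polar F (y - z)"
      by simp
  qed
  from this[of x y] this[of y x] show ?thesis
    by (simp add: dist_norm norm_minus_commute)
qed

text \<open>A ball around x inside the open domain misses the frontier, so its radius, divided by C,
  bounds all the polar distances from below.\<close>

lemma dF_pos:
  fixes F :: "'a::euclidean_space \<Rightarrow> real"
  assumes c: "c > 0" "\<And>x. c * norm x \<le> F x" and C: "C > 0" "\<And>x. F x \<le> C * norm x"
    and "frontier \<Omega> \<noteq> {}" "open \<Omega>" "x \<in> \<Omega>"
  shows "dF F \<Omega> x > 0"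
proof -
  obtain r where r: "r > 0" "ball x r \<subseteq> \<Omega>"
    using assms open_contains_ball by blast
  have "r / C \<le> polar F (x - z)" if "z \<in> frontier \<Omega>" for z
  proof -
    have "z \<notin> \<Omega>"
      using that \<open>open \<Omega>\<close> by (simp add: frontier_def interior_open)
    then have "r \<le> norm (x - z)"
      using r(2) by (auto simp: dist_norm subset_iff not_less)
    then have "r / C \<le> norm (x - z) / C"
      using C(1) by (simp add: divide_right_mono)
    also have "\<dots> \<le> polar F (x - z)"
      by (rule polar_ge_norm[OF c C])
    finally show ?thesis .
  qed
  then have "r / C \<le> dF F \<Omega> x"
    unfolding dF_def using assms by (intro cINF_greatest) auto
  moreover have "r / C > 0" using r C by simp
  ultimately show ?thesis by linarith
qed

section \<open>Gradients and supports of test functions\<close>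

lemma has_derivative_grad:
  fixes v :: "'a::euclidean_space \<Rightarrow> real"
  assumes "v differentiable (at x)"
  shows "(v has_derivative (\<lambda>h. grad v x \<bullet> h)) (at x)"
proof -
  have D: "(v has_derivative frechet_derivative v (at x)) (at x)"
    using assms frechet_derivative_works by blast
  then interpret bounded_linear "frechet_derivative v (at x)"
    by (rule has_derivative_bounded_linear)
  have "frechet_derivative v (at x) h = grad v x \<bullet> h" for h
  proof -
    have "frechet_derivative v (at x) h = frechet_derivative v (at x) (\<Sum>b\<in>Basis. (h \<bullet> b) *\<^sub>R b)"
      by (simp add: euclidean_representation)
    also have "\<dots> = grad v x \<bullet> h"
      by (simp add: sum scaleR grad_def inner_sum_left inner_commute[of h] mult.commute)
    finally show ?thesis .
  qed
  then have "frechet_derivative v (at x) = (\<lambda>h. grad v x \<bullet> h)" by blast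
  with D show ?thesis by simp
qed

lemma Cc_infty_facts:
  fixes v :: "'a::euclidean_space \<Rightarrow> real"
  assumes "v \<in> Cc_infty \<Omega>"
  shows "\<And>x. v differentiable (at x)" "continuous_on UNIV v" "continuous_on UNIV (grad v)"
    "compact (closure {x. v x \<noteq> 0})" "closure {x. v x \<noteq> 0} \<subseteq> \<Omega>"
    "\<And>x. x \<notin> closure {x. v x \<noteq> 0} \<Longrightarrow> v x = 0"
    "\<And>x. x \<notin> closure {x. v x \<noteq> 0} \<Longrightarrow> grad v x = 0"
proof -
  have "Ck 1 v"
    using assms by (auto simp: Cc_infty_def smooth_def)
  then show diff: "\<And>x. v differentiable (at x)" and "continuous_on UNIV v"
    and "continuous_on UNIV (grad v)"
    by (auto simp: grad_def[abs_def] intro!: continuous_intros)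
  show "compact (closure {x. v x \<noteq> 0})" "closure {x. v x \<noteq> 0} \<subseteq> \<Omega>"
    using assms by (auto simp: Cc_infty_def)
  show *: "v x = 0" if "x \<notin> closure {x. v x \<noteq> 0}" for x
    using that closure_subset[of "{x. v x \<noteq> 0}"] by blast
  show "grad v x = 0" if "x \<notin> closure {x. v x \<noteq> 0}" for x
  proof -
    have "(v has_derivative (\<lambda>_. 0)) (at x)"
    proof (rule has_derivative_transform_within_open[OF has_derivative_const])
      show "x \<in> - closure {x. v x \<noteq> 0}" using that by blast
      show "0 = v y" if "y \<in> - closure {x. v x \<noteq> 0}" for y
        using *[of y] that by (metis ComplD)
      show "open (- closure {x. v x \<noteq> 0})" by (rule open_Compl[OF closed_closure])
    qed
    then have "frechet_derivative v (at x) = (\<lambda>_. 0)"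
      using frechet_derivative_at by metis
    then show ?thesis by (simp add: grad_def)
  qed
qed

text \<open>The open sets \<Omega> and - K cover the space. Negative powers of the distance are
  controlled only inside \<Omega>, and the compactly supported factor takes care of the
  rest.\<close>

lemma continuous_on_glue_zero:
  fixes h :: "'a::euclidean_space \<Rightarrow> real"
  assumes "open \<Omega>" "continuous_on \<Omega> h" "closed K" "K \<subseteq> \<Omega>" "\<And>x. x \<notin> K \<Longrightarrow> h x = 0"
  shows "continuous_on UNIV h"
proof -
  have "continuous_on (- K) h"
    by (rule continuous_on_eq[of _ "\<lambda>_. 0"]) (use assms in auto)
  then have "continuous_on (\<Omega> \<union> - K) h"
    using assms by (intro continuous_on_open_Un) auto
  moreover have "\<Omega> \<union> - K = UNIV" using assms by auto
  ultimately show ?thesis by simp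
qed

section \<open>The weighted inequality\<close>

text \<open>Young's inequality with constant 1, by comparing y d with r: in either case one of the
  two terms on the right dominates alone.\<close>

lemma cpowr_mult_le:
  fixes d r y p :: real
  assumes "d > 0" "r \<ge> 0" "y \<ge> 0" "p \<ge> 1"
  shows "cpowr r (p - 1) * y \<le> r powr p / d + d powr (p - 1) * y powr p"
proof (cases "p = 1")
  case True
  then show ?thesis using assms by (simp add: cpowr_def)
next
  case p: False
  show ?thesis
  proof (cases "y * d \<le> r")
    case True
    then have "y \<le> r / d" using assms by (simp add: field_simps)
    then have "cpowr r (p - 1) * y \<le> r powr (p - 1) * (r / d)"
      using p mult_left_mono[of y "r / d" "r powr (p - 1)"] by (simp add: cpowr_def)
    also have "\<dots> = r powr p / d"
      using assms by (cases "r = 0") (auto simp: powr_diff)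
    finally show ?thesis by (simp add: add_increasing2)
  next
    case False
    then have "y > 0" using assms by (cases "y = 0") auto
    have "cpowr r (p - 1) * y \<le> (y * d) powr (p - 1) * y"
      using p assms False by (auto simp: cpowr_def intro!: mult_right_mono powr_mono2)
    also have "\<dots> = d powr (p - 1) * y powr p"
      using \<open>y > 0\<close> \<open>d > 0\<close> by (simp add: powr_mult powr_diff)
    finally show ?thesis using assms by (simp add: add_increasing)
  qed
qed

text \<open>The equations for s and a match the powers of r and d in (r^p / d)^(1-\<mu>) (d^\<beta>
  r^q)^\<mu>, so the first bound just drops the term with y. The second reduces to the first if y d
  \<le> r; otherwise surplus powers of r are traded for y d, which produces the term with y.\<close>

lemma weighted_powr_interpolation:
  fixes d r y p q s a \<beta> \<mu> :: real
  assumes "d > 0" "r \<ge> 0" "y \<ge> 0" "p > 1" "s > 1"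
    and \<mu>: "0 \<le> \<mu>" "\<mu> \<le> 1 - 1 / p"
    and s: "s = p * (1 - \<mu>) + q * \<mu>" and a: "a = \<mu> + \<beta> * \<mu>"
  shows "d powr (a - 1) * r powr s
      \<le> (r powr p / d + d powr (p - 1) * y powr p) powr (1 - \<mu>) * (d powr \<beta> * r powr q) powr \<mu>" (is "_ \<le> ?R")
    and "d powr a * (cpowr r (s - 1) * y)
      \<le> (r powr p / d + d powr (p - 1) * y powr p) powr (1 - \<mu>) * (d powr \<beta> * r powr q) powr \<mu>"
proof -
  have "1 / p > 0" using \<open>p > 1\<close> by simp
  then have "\<mu> < 1" using \<mu> by linarith
  have X: "d powr (a - 1) * r powr s \<le> ?R"
  proof (cases "r = 0")
    case False
    then have "r > 0" using assms by simp
    have "d powr (a - 1) * r powr s = (r powr p / d) powr (1 - \<mu>) * (d powr \<beta> * r powr q) powr \<mu>"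
    proof -
      have "(r powr p / d) powr (1 - \<mu>) = (r powr p * d powr (- 1)) powr (1 - \<mu>)"
        using \<open>d > 0\<close> by (simp add: powr_minus divide_inverse)
      also have "\<dots> = r powr (p * (1 - \<mu>)) * d powr (- (1 - \<mu>))"
        by (simp only: powr_mult powr_powr) simp
      finally have "(r powr p / d) powr (1 - \<mu>) * (d powr \<beta> * r powr q) powr \<mu>
          = (d powr (- (1 - \<mu>)) * d powr (\<beta> * \<mu>)) * (r powr (p * (1 - \<mu>)) * r powr (q * \<mu>))"
        by (simp add: powr_mult powr_powr)
      also have "\<dots> = d powr (a - 1) * r powr s"
        unfolding powr_add[symmetric] s a by (simp add: algebra_simps)
      finally show ?thesis ..
    qed
    also have "\<dots> \<le> ?R"
      using assms \<open>\<mu> < 1\<close> by (intro mult_right_mono powr_mono2) auto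
    finally show ?thesis .
  qed simp
  then show "d powr (a - 1) * r powr s \<le> ?R" .
  show "d powr a * (cpowr r (s - 1) * y) \<le> ?R"
  proof (cases "y * d \<le> r")
    case True
    then have "y \<le> r / d" using assms by (simp add: field_simps)
    then have "d powr a * (cpowr r (s - 1) * y) \<le> d powr a * (r powr (s - 1) * (r / d))"
      using \<open>s > 1\<close> mult_left_mono[of y "r / d" "r powr (s - 1)"]
      unfolding cpowr_def by (intro mult_left_mono) auto
    also have "\<dots> = d powr (a - 1) * r powr s"
      using assms by (cases "r = 0") (auto simp: powr_diff)
    finally show ?thesis using X by linarith
  next
    case False
    then have "y > 0" using assms by (cases "y = 0") auto
    show ?thesis
    proof (cases "r = 0")
      case True
      then show ?thesis using \<open>s > 1\<close> by (simp add: cpowr_def)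
    next
      case r: False
      \<comment> \<open>What remains of r^(s-1) after splitting off r^(q \<mu>). The assumption
        \<mu> \<le> 1 - 1/p says precisely that e \<ge> 0, so that trading r for y d is
        monotone.\<close>
      define e where "e = p * (1 - \<mu>) - 1"
      have "e \<ge> 0"
        using \<mu> \<open>p > 1\<close> by (simp add: e_def field_simps)
      have "r powr e \<le> (y * d) powr e"
        using False assms \<open>e \<ge> 0\<close> by (intro powr_mono2) auto
      also have "\<dots> = y powr e * d powr e"
        by (rule powr_mult)
      finally have re: "r powr e \<le> y powr e * d powr e" .
      have "r powr (s - 1) = r powr (q * \<mu>) * r powr e"
        unfolding powr_add[symmetric] s e_def by (simp add: algebra_simps)
      then have "d powr a * (cpowr r (s - 1) * y) = d powr a * (r powr (q * \<mu>) * r powr e * y powr 1)"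
        using \<open>s > 1\<close> \<open>y > 0\<close> by (simp add: cpowr_def)
      also have "\<dots> \<le> d powr a * (r powr (q * \<mu>) * (y powr e * d powr e) * y powr 1)"
        by (intro mult_left_mono mult_right_mono re) auto
      also have "\<dots> = (d powr a * d powr e) * r powr (q * \<mu>) * (y powr e * y powr 1)"
        by (simp add: mult_ac)
      also have "\<dots> = d powr ((p - 1) * (1 - \<mu>) + \<beta> * \<mu>) * r powr (q * \<mu>) * y powr (p * (1 - \<mu>))"
        unfolding powr_add[symmetric] a e_def by (simp add: algebra_simps)
      also have "\<dots> = (d powr (p - 1) * y powr p) powr (1 - \<mu>) * (d powr \<beta> * r powr q) powr \<mu>"
        by (simp add: powr_mult powr_powr powr_add mult_ac)
      also have "\<dots> \<le> ?R"
        using assms \<open>\<mu> < 1\<close> by (intro mult_right_mono powr_mono2) auto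
      finally show ?thesis .
    qed
  qed
qed

text \<open>Of the distance only positivity on \<Omega> and the Lipschitz bound are kept, and
  gradients are measured in the Euclidean norm; F comes back by norm equivalence at the end.\<close>

locale weighted_test_function =
  fixes \<Omega> K :: "'a::euclidean_space set" and d v :: "'a \<Rightarrow> real" and L :: real
  assumes dim: "DIM('a) \<ge> 2"
    and open_\<Omega>: "open \<Omega>" and compact_K: "compact K" and K_sub: "K \<subseteq> \<Omega>"
    and L: "L \<ge> 0" and d_lip: "\<And>x y. \<bar>d x - d y\<bar> \<le> L * dist x y" and d_pos: "\<And>x. x \<in> \<Omega> \<Longrightarrow> d x > 0"
    and v_diff: "\<And>x. v differentiable (at x)" and v_cont: "continuous_on UNIV v"
    and grad_cont: "continuous_on UNIV (grad v)"
    and v_supp: "\<And>x. x \<notin> K \<Longrightarrow> v x = 0" and grad_supp: "\<And>x. x \<notin> K \<Longrightarrow> grad v x = 0"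
begin

lemma d_cont: "continuous_on S d"
proof -
  have "(d \<longlongrightarrow> d x) (nhds x)" for x
    using slope_le_imp_tendsto[OF slope_le_lipschitz[of d x L, OF d_lip]] .
  then have "continuous_on UNIV d"
    by (simp add: continuous_on_eq_continuous_at isCont_def tendsto_at_iff_tendsto_nhds)
  then show ?thesis by (rule continuous_on_subset) auto
qed

lemma v_cont': "continuous_on S v" and grad_cont': "continuous_on S (grad v)"
  using v_cont grad_cont continuous_on_subset by blast+

lemma cont_supp:
  fixes h :: "'a \<Rightarrow> real"
  assumes "continuous_on \<Omega> h" "\<And>x. x \<notin> K \<Longrightarrow> h x = 0"
  shows "continuous_on UNIV h" and "integrable lborel h"
proof -
  show c: "continuous_on UNIV h"
    using continuous_on_glue_zero[OF open_\<Omega> assms(1) compact_imp_closed[OF compact_K] K_sub assms(2)] .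
  show "integrable lborel h"
    by (rule integrable_continuous_support[OF c compact_K assms(2)])
qed

lemma d_nz: "x \<in> \<Omega> \<Longrightarrow> d x \<noteq> 0" and d_nn: "x \<in> \<Omega> \<Longrightarrow> d x \<ge> 0"
  using d_pos by force+

text \<open>g is what the product and chain rules give for d^a |v|^s when the slope of d is replaced
  by the constant L. That replacement keeps g continuous on \<Omega>.\<close>

lemma weighted_Sobolev:
  assumes "a \<ge> 0" "s \<ge> 1"
  defines "g \<equiv> \<lambda>x. d x powr a * (s * cpowr \<bar>v x\<bar> (s - 1) * norm (grad v x)) +
      \<bar>v x\<bar> powr s * (a * d x powr (a - 1) * L)"
  shows "integrable lborel g"
    and "(\<integral>x. (d x powr a * \<bar>v x\<bar> powr s) powr (real DIM('a) / (real DIM('a) - 1)) \<partial>lborel)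
      \<le> (\<integral>x. g x \<partial>lborel) powr (real DIM('a) / (real DIM('a) - 1))"
proof -
  \<comment> \<open>For s = 1 the factor \<open>cpowr 0 0\<close> is 1, so off K the first term
    vanishes through the gradient and not through v.\<close>
  have g0: "g x = 0" if "x \<notin> K" for x
    using v_supp[OF that] grad_supp[OF that] assms by (simp add: g_def)
  have g_cont: "continuous_on \<Omega> g"
    unfolding g_def using assms d_nz
    by (intro continuous_intros continuous_on_powr' d_cont v_cont' grad_cont') auto
  show "integrable lborel g"
    by (rule cont_supp[OF g_cont g0])
  have g_nonneg: "g x \<ge> 0" for x
    unfolding g_def using assms L by (intro add_nonneg_nonneg mult_nonneg_nonneg) auto
  have slope: "slope_le (\<lambda>x. d x powr a * \<bar>v x\<bar> powr s) x (g x)" for x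
  proof (cases "x \<in> K")
    case True
    then have dx: "d x > 0" using K_sub d_pos by blast
    have "slope_le (\<lambda>x. d x powr a) x (a * d x powr (a - 1) * L)"
      using dx assms L d_lip
      by (intro slope_le_compose[where h = "\<lambda>r. r powr a"] slope_le_lipschitz slope_le_powr) auto
    moreover have "slope_le v x (norm (grad v x))"
      by (intro slope_le_has_derivative[OF has_derivative_grad[OF v_diff]])
         (simp add: Cauchy_Schwarz_ineq2)
    then have "slope_le (\<lambda>x. \<bar>v x\<bar> powr s) x (s * cpowr \<bar>v x\<bar> (s - 1) * norm (grad v x))"
      using assms by (intro slope_le_compose[where h = "\<lambda>u. \<bar>u\<bar> powr s"] slope_le_abs_powr) auto
    ultimately have "slope_le (\<lambda>x. d x powr a * \<bar>v x\<bar> powr s) x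
        (\<bar>d x powr a\<bar> * (s * cpowr \<bar>v x\<bar> (s - 1) * norm (grad v x)) +
         \<bar>\<bar>v x\<bar> powr s\<bar> * (a * d x powr (a - 1) * L))"
      using assms L by (intro slope_le_mult) auto
    then show ?thesis by (simp add: g_def)
  next
    case False
    have "\<forall>\<^sub>F y in nhds x. y \<in> - K"
      using False compact_imp_closed[OF compact_K] by (intro eventually_nhds_in_open) auto
    then have "\<forall>\<^sub>F y in nhds x. d y powr a * \<bar>v y\<bar> powr s = 0"
      by eventually_elim (simp add: v_supp)
    moreover have "slope_le (\<lambda>_. 0) x 0"
      by (rule slope_le_lipschitz) simp
    ultimately show ?thesis
      unfolding g0[OF False] by (rule slope_le_cong)
  qed
  show "(\<integral>x. (d x powr a * \<bar>v x\<bar> powr s) powr (real DIM('a) / (real DIM('a) - 1)) \<partial>lborel)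
      \<le> (\<integral>x. g x \<partial>lborel) powr (real DIM('a) / (real DIM('a) - 1))"
    using v_supp
    by (intro Sobolev_slope[OF dim _ cont_supp(1)[OF g_cont g0] g_nonneg slope compact_K _ g0]) auto
qed

section \<open>The energy density and the two ranges of t\<close>

definition energy :: "real \<Rightarrow> 'a \<Rightarrow> real" where
  "energy p x = \<bar>v x\<bar> powr p / d x + d x powr (p - 1) * norm (grad v x) powr p"

lemma integrable_energy:
  assumes "p \<ge> 1"
  shows "integrable lborel (energy p)"
proof (rule cont_supp)
  show "continuous_on \<Omega> (energy p)"
    unfolding energy_def[abs_def] using assms d_nz d_nn
    by (intro continuous_intros continuous_on_powr' d_cont v_cont' grad_cont') auto
  show "energy p x = 0" if "x \<notin> K" for x
    using v_supp[OF that] grad_supp[OF that] by (simp add: energy_def)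
qed

lemma integrable_weighted_powr:
  assumes "e > 0"
  shows "integrable lborel (\<lambda>x. d x powr \<beta> * \<bar>v x\<bar> powr e)"
proof (rule cont_supp)
  show "continuous_on \<Omega> (\<lambda>x. d x powr \<beta> * \<bar>v x\<bar> powr e)"
    using assms d_nz d_nn
    by (intro continuous_intros continuous_on_powr' d_cont v_cont') auto
qed (simp add: v_supp)

lemma energy_nonneg_K: "x \<in> K \<Longrightarrow> energy p x \<ge> 0"
  using K_sub d_nn[of x] by (auto simp: energy_def)

lemma energy_supp: "p \<ge> 1 \<Longrightarrow> x \<notin> K \<Longrightarrow> energy p x = 0"
  using v_supp[of x] grad_supp[of x] by (simp add: energy_def)

text \<open>The locale leaves the sign of d outside \<Omega> open, but off K the energy is
  0.\<close>

lemma energy_nonneg: "p \<ge> 1 \<Longrightarrow> energy p x \<ge> 0"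
  using energy_nonneg_K energy_supp by (cases "x \<in> K") auto

text \<open>With a = 0 the term containing L disappears, so the constant p depends neither on d nor
  on F. The assumption t \<le> 1 makes the interpolation parameter \<theta> nonnegative.\<close>

lemma subcritical_bound:
  fixes p t :: real
  defines "n \<equiv> real DIM('a)"
  assumes "p \<ge> 1" "0 < t" "t \<le> 1"
  shows "(\<integral>x. d x powr (n * (t - 1) / (n - t)) * \<bar>v x\<bar> powr (n * p / (n - t)) \<partial>lborel)
    powr ((n - t) / n) \<le> p * (\<integral>x. energy p x \<partial>lborel)"
proof -
  have n: "n \<ge> 2" using dim by (simp add: n_def)
  define q where "q = n * p / (n - t)"
  define q0 where "q0 = p * n / (n - 1)"
  \<comment> \<open>Chosen so that -\<theta> is the exponent of d and q0 (1 - \<theta>) + p \<theta>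
    = q: where v is nonzero the integrand is then (|v|^q0)^(1-\<theta>) (|v|^p /
    d)^\<theta>.\<close>
  define \<theta> where "\<theta> = n * (1 - t) / (n - t)"
  have q: "q > 0" "q0 > 0" using assms n by (auto simp: q_def q0_def)
  have \<theta>: "0 \<le> \<theta>" "\<theta> \<le> 1" using assms n by (auto simp: \<theta>_def field_simps)
  have \<theta>': "1 - \<theta> = t * (n - 1) / (n - t)"
    using assms n by (simp add: \<theta>_def field_simps)
  have q_eq: "q0 * (1 - \<theta>) + p * \<theta> = q"
    using assms n unfolding \<theta>' unfolding q_def q0_def \<theta>_def by (simp add: divide_simps) (simp add: algebra_simps)
  define A where "A = (\<integral>x. energy p x \<partial>lborel)"
  have "A \<ge> 0" unfolding A_def using energy_nonneg assms by simp
  define Z0 where "Z0 = (\<integral>x. \<bar>v x\<bar> powr q0 \<partial>lborel)"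
  define Z where "Z = (\<integral>x. d x powr (- \<theta>) * \<bar>v x\<bar> powr q \<partial>lborel)"
  have Z0: "Z0 \<le> (p * A) powr (n / (n - 1))"
  proof -
    have "Z0 = (\<integral>x. (d x powr 0 * \<bar>v x\<bar> powr p) powr (n / (n - 1)) \<partial>lborel)"
      unfolding Z0_def
    \<comment> \<open>\<open>d x powr 0\<close> is 1 only where \<open>d x\<close> is nonzero, hence
      the separate look at points off K, where both sides vanish.\<close>
    proof (intro Bochner_Integration.integral_cong refl)
      fix x show "\<bar>v x\<bar> powr q0 = (d x powr 0 * \<bar>v x\<bar> powr p) powr (n / (n - 1))"
        using v_supp[of x] K_sub d_nz[of x] by (cases "x \<in> K") (auto simp: powr_powr q0_def)
    qed
    also have "\<dots> \<le> (\<integral>x. d x powr 0 * (p * cpowr \<bar>v x\<bar> (p - 1) * norm (grad v x)) +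
      \<bar>v x\<bar> powr p * (0 * d x powr (0 - 1) * L) \<partial>lborel) powr (n / (n - 1))"
      using weighted_Sobolev(2)[of 0 p] assms by (simp add: n_def)
    also have "\<dots> \<le> (p * A) powr (n / (n - 1))"
    proof (rule powr_mono2)
      show "(\<integral>x. d x powr 0 * (p * cpowr \<bar>v x\<bar> (p - 1) * norm (grad v x)) +
        \<bar>v x\<bar> powr p * (0 * d x powr (0 - 1) * L) \<partial>lborel) \<le> p * A"
        unfolding A_def integral_mult_right_zero[symmetric]
      proof (intro integral_mono weighted_Sobolev(1))
        fix x
        show "d x powr 0 * (p * cpowr \<bar>v x\<bar> (p - 1) * norm (grad v x)) +
          \<bar>v x\<bar> powr p * (0 * d x powr (0 - 1) * L) \<le> p * energy p x"
        proof (cases "x \<in> K")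
          case True
          then have "d x > 0" using K_sub d_pos by blast
          from cpowr_mult_le[OF this _ _ assms(2), of "\<bar>v x\<bar>" "norm (grad v x)"]
          show ?thesis using \<open>d x > 0\<close> assms by (simp add: energy_def mult.assoc)
        next
          case False
          then show ?thesis using v_supp[of x] grad_supp[of x] assms by (simp add: energy_supp)
        qed
      qed (use assms in \<open>auto intro: integrable_energy\<close>)
    qed (use n assms in \<open>auto intro!: Bochner_Integration.integral_nonneg\<close>)
    finally show ?thesis .
  qed
  have "integrable lborel (\<lambda>x. \<bar>v x\<bar> powr q0)"
  proof (rule cont_supp)
    show "continuous_on \<Omega> (\<lambda>x. \<bar>v x\<bar> powr q0)"
      using q by (intro continuous_intros continuous_on_powr' v_cont') auto
  qed (simp add: v_supp)
  note H = Holder_two[OF this integrable_energy[OF \<open>p \<ge> 1\<close>] _ energy_nonneg[OF \<open>p \<ge> 1\<close>] \<theta>, simplified]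
  have "Z \<le> (\<integral>x. (\<bar>v x\<bar> powr q0) powr (1 - \<theta>) * (energy p x) powr \<theta> \<partial>lborel)"
    unfolding Z_def
  proof (rule integral_mono')
    fix x
    show "d x powr (- \<theta>) * \<bar>v x\<bar> powr q \<le> (\<bar>v x\<bar> powr q0) powr (1 - \<theta>) * (energy p x) powr \<theta>"
    proof (cases "v x = 0")
      case False
      then have "d x > 0" using K_sub d_pos v_supp by blast
      have "d x powr (- \<theta>) * \<bar>v x\<bar> powr q = (\<bar>v x\<bar> powr q0) powr (1 - \<theta>) * (\<bar>v x\<bar> powr p * d x powr (-1)) powr \<theta>"
        unfolding q_eq[symmetric] by (simp only: powr_mult powr_powr powr_add) simp
      also have "\<bar>v x\<bar> powr p * d x powr (-1) = \<bar>v x\<bar> powr p / d x"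
        using \<open>d x > 0\<close> by (simp add: powr_minus divide_inverse)
      also have "(\<bar>v x\<bar> powr q0) powr (1 - \<theta>) * (\<bar>v x\<bar> powr p / d x) powr \<theta> \<le> (\<bar>v x\<bar> powr q0) powr (1 - \<theta>) * (energy p x) powr \<theta>"
        using \<open>d x > 0\<close> \<theta> by (intro mult_left_mono powr_mono2) (auto simp: energy_def)
      finally show ?thesis .
    qed simp
  qed (use H(1) in auto)
  also have "\<dots> \<le> Z0 powr (1 - \<theta>) * A powr \<theta>"
    unfolding Z0_def A_def by (rule H(2))
  \<comment> \<open>A \<le> p A because p \<ge> 1. With the common base p A the exponents add up to
    n/(n - t), which the outer power (n - t)/n cancels.\<close>
  also have "\<dots> \<le> ((p * A) powr (n / (n - 1))) powr (1 - \<theta>) * (p * A) powr \<theta>"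
    using Z0 \<theta> \<open>A \<ge> 0\<close> \<open>p \<ge> 1\<close> mult_right_mono[of 1 p A]
    by (intro mult_mono powr_mono2) (auto simp: Z0_def)
  also have "\<dots> = (p * A) powr (n / (n - 1) * (1 - \<theta>) + \<theta>)"
    by (simp add: powr_powr powr_add)
  also have "n / (n - 1) * (1 - \<theta>) + \<theta> = n / (n - t)"
    using assms n unfolding \<theta>' unfolding \<theta>_def by (simp add: divide_simps) (simp add: algebra_simps)
  finally have "Z powr ((n - t) / n) \<le> ((p * A) powr (n / (n - t))) powr ((n - t) / n)"
    using assms n by (intro powr_mono2) (auto simp: Z_def)
  also have "\<dots> = p * A"
    using assms n \<open>A \<ge> 0\<close> by (simp add: powr_powr)
  moreover have "- \<theta> = n * (t - 1) / (n - t)"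
    unfolding \<theta>_def minus_divide_left by (simp add: algebra_simps)
  ultimately show ?thesis
    by (simp add: Z_def q_def A_def)
qed

text \<open>a and s are (n - 1)/n times the exponents of d and |v| in W, so the Sobolev power of d^a
  |v|^s is W itself. M = s + a L collects the factors of the two gradient terms; it appears to the
  power t because the absorbed inequality is raised to that power.\<close>

lemma supercritical_bound:
  fixes p t :: real
  defines "n \<equiv> real DIM('a)"
  assumes "1 < t" "t \<le> p" "t < n"
  shows "(\<integral>x. d x powr (n * (t - 1) / (n - t)) * \<bar>v x\<bar> powr (n * p / (n - t)) \<partial>lborel)
    powr ((n - t) / n) \<le>
      (p * (n - 1) / (n - t) + (n - 1) * (t - 1) / (n - t) * L) powr t * (\<integral>x. energy p x \<partial>lborel)"
proof -
  have n: "n \<ge> 2" using dim by (simp add: n_def)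
  define q where "q = n * p / (n - t)"
  define \<beta> where "\<beta> = n * (t - 1) / (n - t)"
  define s where "s = p * (n - 1) / (n - t)"
  define a where "a = (n - 1) * (t - 1) / (n - t)"
  \<comment> \<open>The value that solves both s = p (1 - \<mu>) + q \<mu> and a = \<mu> + \<beta>
    \<mu>; \<mu> \<le> 1 - 1/p then amounts to t \<le> p.\<close>
  define \<mu> where "\<mu> = 1 - 1 / t"
  define M where "M = s + a * L"
  have \<mu>: "0 \<le> \<mu>" "\<mu> \<le> 1 - 1 / p" "\<mu> \<le> 1" and l1: "1 - \<mu> = 1 / t"
    using assms by (auto simp: \<mu>_def field_simps)
  have s1: "s > 1"
  proof -
    have "n - t < 1 * (n - 1)" using assms by simp
    also have "\<dots> \<le> p * (n - 1)" using assms n by (intro mult_right_mono) auto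
    finally show ?thesis using assms by (simp add: s_def field_simps)
  qed
  have a0: "a \<ge> 0" using assms n by (simp add: a_def)
  have M: "M > 0" using s1 a0 L by (simp add: M_def add_pos_nonneg)
  have s_eq: "s = p * (1 - \<mu>) + q * \<mu>"
    using assms n unfolding s_def \<mu>_def q_def by (simp add: divide_simps) (simp add: algebra_simps)
  have a_eq: "a = \<mu> + \<beta> * \<mu>"
    using assms n unfolding a_def \<mu>_def \<beta>_def by (simp add: divide_simps) (simp add: algebra_simps)
  define A where "A = (\<integral>x. energy p x \<partial>lborel)"
  have "A \<ge> 0" unfolding A_def using energy_nonneg assms by simp
  define W where "W x = d x powr \<beta> * \<bar>v x\<bar> powr q" for x
  define Z where "Z = (\<integral>x. W x \<partial>lborel)"
  have intW: "integrable lborel W"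
    unfolding W_def using assms n by (intro integrable_weighted_powr) (simp add: q_def)
  note H = Holder_two[OF integrable_energy[of p] intW _ _ \<mu>(1,3)]
  have Z: "Z \<le> (M * (A powr (1 - \<mu>) * Z powr \<mu>)) powr (n / (n - 1))"
  proof -
    let ?g = "\<lambda>x. d x powr a * (s * cpowr \<bar>v x\<bar> (s - 1) * norm (grad v x)) +
      \<bar>v x\<bar> powr s * (a * d x powr (a - 1) * L)"
    have "\<beta> = a * (n / (n - 1))" "q = s * (n / (n - 1))"
      using n by (auto simp: \<beta>_def a_def q_def s_def)
    then have "Z = (\<integral>x. (d x powr a * \<bar>v x\<bar> powr s) powr (n / (n - 1)) \<partial>lborel)"
      unfolding Z_def W_def by (simp add: powr_mult powr_powr)
    also have "\<dots> \<le> (\<integral>x. ?g x \<partial>lborel) powr (n / (n - 1))"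
      unfolding n_def using s1 a0 by (intro weighted_Sobolev(2)) auto
    also have "\<dots> \<le> (M * (A powr (1 - \<mu>) * Z powr \<mu>)) powr (n / (n - 1))"
    proof (rule powr_mono2)
      have "(\<integral>x. ?g x \<partial>lborel) \<le> (\<integral>x. M * (energy p x powr (1 - \<mu>) * W x powr \<mu>) \<partial>lborel)"
      proof (intro integral_mono weighted_Sobolev(1))
        fix x
        show "?g x \<le> M * (energy p x powr (1 - \<mu>) * W x powr \<mu>)"
        proof (cases "x \<in> K")
          case True
          then have "d x > 0" using K_sub d_pos by blast
          note I = weighted_powr_interpolation[OF this abs_ge_zero[of "v x"] norm_ge_zero[of "grad v x"] _ s1 \<mu>(1,2) s_eq a_eq]
          have "s * (d x powr a * (cpowr \<bar>v x\<bar> (s - 1) * norm (grad v x))) \<le> s * (energy p x powr (1 - \<mu>) * W x powr \<mu>)"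
            unfolding energy_def W_def using s1 assms by (intro mult_left_mono I(2)) auto
          moreover have "a * L * (d x powr (a - 1) * \<bar>v x\<bar> powr s) \<le> a * L * (energy p x powr (1 - \<mu>) * W x powr \<mu>)"
            unfolding energy_def W_def using a0 L assms by (intro mult_left_mono I(1)) auto
          ultimately show ?thesis
            by (simp add: M_def algebra_simps)
        next
          case False
          then show ?thesis
            using v_supp[of x] grad_supp[of x] assms by (simp add: energy_supp)
        qed
      qed (use s1 a0 assms energy_nonneg H(1) in \<open>auto simp: W_def\<close>)
      also have "\<dots> \<le> M * (A powr (1 - \<mu>) * Z powr \<mu>)"
        using H(2) M assms energy_nonneg by (auto simp: W_def A_def Z_def)
      finally show "(\<integral>x. ?g x \<partial>lborel) \<le> M * (A powr (1 - \<mu>) * Z powr \<mu>)" .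
      show "0 \<le> (\<integral>x. ?g x \<partial>lborel)"
        using s1 a0 L by (intro Bochner_Integration.integral_nonneg add_nonneg_nonneg mult_nonneg_nonneg) auto
    qed (use n in auto)
    finally show ?thesis .
  qed
  have "Z powr ((n - t) / n) \<le> M powr t * A"
  \<comment> \<open>Absorption divides by Z^\<mu>, so Z = 0 is set aside; by \<open>intW\<close> the
    number Z is a genuine finite integral and not a default value.\<close>
  proof (cases "Z = 0")
    case True
    then show ?thesis using \<open>A \<ge> 0\<close> by simp
  next
    case False
    then have "Z > 0"
      by (simp add: Z_def W_def order_less_le)
    have "Z powr ((n - 1) / n) \<le> ((M * (A powr (1 - \<mu>) * Z powr \<mu>)) powr (n / (n - 1))) powr ((n - 1) / n)"
      using Z n \<open>Z > 0\<close> by (intro powr_mono2) auto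
    also have "\<dots> = M * A powr (1 / t) * Z powr \<mu>"
      using n M by (simp add: powr_powr l1)
    \<comment> \<open>The exponent left on Z is (n - t)/(n t); the power t then turns it into (n -
      t)/n and A^(1/t) into A.\<close>
    finally have "Z powr ((n - 1) / n) * Z powr (- \<mu>) \<le> M * A powr (1 / t) * Z powr \<mu> * Z powr (- \<mu>)"
      by (intro mult_right_mono) auto
    also have "\<dots> = M * A powr (1 / t)"
      using \<open>Z > 0\<close> by (simp add: powr_minus)
    finally have ZM: "Z powr ((n - 1) / n) * Z powr (- \<mu>) \<le> M * A powr (1 / t)" .
    then have "Z powr ((n - t) / (n * t)) \<le> M * A powr (1 / t)"
    proof -
      have "(n - 1) / n + (- \<mu>) = (n - t) / (n * t)"
        using n assms by (simp add: \<mu>_def field_simps)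
      then show ?thesis
        using ZM by (simp only: powr_add[symmetric])
    qed
    then have "(Z powr ((n - t) / (n * t))) powr t \<le> (M * A powr (1 / t)) powr t"
      using assms by (intro powr_mono2) auto
    then show ?thesis
      using assms n \<open>A \<ge> 0\<close> by (simp add: powr_powr powr_mult)
  qed
  then show ?thesis
    unfolding Z_def W_def \<beta>_def q_def M_def s_def a_def A_def .
qed

end

section \<open>From whole-space Borel integrals to the stated inequality\<close>

lemma set_integral_lebesgue_eq_lborel:
  fixes h :: "'a::euclidean_space \<Rightarrow> real"
  assumes "h \<in> borel_measurable borel" "\<And>x. x \<notin> \<Omega> \<Longrightarrow> h x = 0"
  shows "(\<integral>x\<in>\<Omega>. h x \<partial>lebesgue) = (\<integral>x. h x \<partial>lborel)"
proof -
  have "indicator \<Omega> x *\<^sub>R h x = h x" for x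
    using assms(2)[of x] by (cases "x \<in> \<Omega>") auto
  then show ?thesis
    using assms(1) integral_completion[of h lborel] by (simp only: set_lebesgue_integral_def) simp
qed

theorem mainTheorem2:
  fixes F :: "'a::euclidean_space \<Rightarrow> real" and p \<alpha> :: real
  assumes "DIM('a) \<ge> 2"
    and "strictly_convex_C1_norm F"
    and "0 \<le> \<alpha>" and "\<alpha> < 1"
    and "1 \<le> p" and "p < real DIM('a) / (1 - \<alpha>)"
  shows "\<exists>C2>0. \<forall>\<Omega> v. domain \<Omega> \<longrightarrow> v \<in> Cc_infty \<Omega> \<longrightarrow>
    (let n = real DIM('a); q = n * p / (n - p * (1 - \<alpha>)); d = dF F \<Omega> in
      (\<integral>x\<in>\<Omega>. \<bar>d x powr (1 - 1 / p - \<alpha>) * v x\<bar> powr q \<partial>lebesgue) powr (p / q)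
      \<le> C2 * (\<integral>x\<in>\<Omega>. (\<bar>v x\<bar> powr p / d x + d x powr (p - 1) * F (grad v x) powr p) \<partial>lebesgue))"
proof -
  obtain c C where c: "c > 0" "\<And>x. c * norm x \<le> F x" and C: "C > 0" "\<And>x. F x \<le> C * norm x"
    using norm_equivalence[OF assms(2)] by metis
  have F_cont: "continuous_on UNIV F"
    using assms(2) unfolding strictly_convex_C1_norm_def by (auto intro: convex_on_continuous)
  have F_nonneg: "F x \<ge> 0" for x
    using assms(2) by (simp add: strictly_convex_C1_norm_def)
  define n where "n = real DIM('a)"
  define t where "t = p * (1 - \<alpha>)"
  \<comment> \<open>The constants of the two bounds, with L = 1/c, the Lipschitz constant of
    \<open>dF\<close>. Only n, p, \<alpha> and c enter, so the choice precedes \<Omega> and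
    v.\<close>
  define M where "M = (if t \<le> 1 then p
    else (p * (n - 1) / (n - t) + (n - 1) * (t - 1) / (n - t) * (1 / c)) powr t)"
  \<comment> \<open>Passing from the Euclidean norm to F costs c^p in the gradient term; the minimum
    with 1 covers |v|^p / d, which both energies share.\<close>
  define m where "m = min 1 (c powr p)"
  have n: "n \<ge> 2" using assms(1) by (simp add: n_def)
  have t: "0 < t" "t \<le> p" "t < n"
    using assms by (auto simp: t_def n_def field_simps)
  have m: "m > 0" using c by (simp add: m_def)
  have M: "M > 0"
  proof (cases "t \<le> 1")
    case False
    then have "p * (n - 1) / (n - t) + (n - 1) * (t - 1) / (n - t) * (1 / c) > 0"
      using n t c assms(5) by (intro add_pos_nonneg) auto
    then show ?thesis using False by (simp add: M_def)
  qed (use assms in \<open>simp add: M_def\<close>)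
  define q where "q = n * p / (n - t)"
  have q: "q > 0" using n t assms by (simp add: q_def)
  have pq: "p / q = (n - t) / n"
    using n t assms by (simp add: q_def)
  \<comment> \<open>\<open>1 - 1 / p\<close> is 1/p', with value 0 for p = 1. Scaling this identity
    by q / p gives the weight exponent of the two bounds.\<close>
  have "(1 - 1 / p - \<alpha>) * p = t - 1"
    using assms(5) by (simp add: t_def field_simps)
  then have bq: "(1 - 1 / p - \<alpha>) * q = n * (t - 1) / (n - t)"
    unfolding q_def by (metis mult.commute mult.left_commute times_divide_eq_right)
  have main: "(\<integral>x\<in>\<Omega>. \<bar>dF F \<Omega> x powr (1 - 1 / p - \<alpha>) * v x\<bar> powr q \<partial>lebesgue) powr (p / q)
      \<le> M / m * (\<integral>x\<in>\<Omega>. (\<bar>v x\<bar> powr p / dF F \<Omega> x + dF F \<Omega> x powr (p - 1) * F (grad v x) powr p) \<partial>lebesgue)"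
    if "domain \<Omega>" "v \<in> Cc_infty \<Omega>" for \<Omega> v
  proof -
    have \<Omega>: "open \<Omega>" "frontier \<Omega> \<noteq> {}"
      using \<open>domain \<Omega>\<close> by (auto simp: domain_def)
    define d where "d = dF F \<Omega>"
    define K where "K = closure {x. v x \<noteq> 0}"
    note v = Cc_infty_facts[OF that(2), folded K_def]
    interpret weighted_test_function \<Omega> K d v "1 / c"
      by standard (use v \<Omega> c dF_lipschitz[of c F C \<Omega>, OF c C \<Omega>(2)] dF_pos[of c F C \<Omega>, OF c C \<Omega>(2,1)]
        assms(1) in \<open>auto simp: d_def\<close>)
    define G where "G x = \<bar>v x\<bar> powr p / d x + d x powr (p - 1) * F (grad v x) powr p" for x
    have F0: "F 0 = 0"
      using c(2)[of 0] C(2)[of 0] by simp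
    have G_supp: "G x = 0" if "x \<notin> K" for x
      using v_supp[OF that] grad_supp[OF that] by (simp add: G_def F0)
    have "continuous_on \<Omega> G"
      unfolding G_def[abs_def] using assms(5) d_nz d_nn F_nonneg
      by (intro continuous_intros continuous_on_powr' d_cont v_cont'
          continuous_on_compose2[OF F_cont grad_cont']) auto
    note G = cont_supp[OF this G_supp]
    have energy_le: "m * energy p x \<le> G x" for x
    proof (cases "x \<in> K")
      case True
      then have "d x > 0" using K_sub d_pos by blast
      have "m * norm (grad v x) powr p \<le> c powr p * norm (grad v x) powr p"
        by (intro mult_right_mono) (auto simp: m_def)
      also have "\<dots> = (c * norm (grad v x)) powr p"
        by (simp add: powr_mult)
      also have "\<dots> \<le> F (grad v x) powr p"
        using c assms(5) by (intro powr_mono2) auto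
      finally have "d x powr (p - 1) * (m * norm (grad v x) powr p) \<le> d x powr (p - 1) * F (grad v x) powr p"
        by (intro mult_left_mono) auto
      moreover have "m * (\<bar>v x\<bar> powr p / d x) \<le> 1 * (\<bar>v x\<bar> powr p / d x)"
        using \<open>d x > 0\<close> by (intro mult_right_mono) (auto simp: m_def)
      ultimately show ?thesis
        unfolding G_def energy_def by (simp add: algebra_simps)
    next
      case False
      then show ?thesis using G_supp energy_supp assms(5) by simp
    qed
    have "(\<integral>x\<in>\<Omega>. \<bar>d x powr (1 - 1 / p - \<alpha>) * v x\<bar> powr q \<partial>lebesgue)
        = (\<integral>x. d x powr (n * (t - 1) / (n - t)) * \<bar>v x\<bar> powr q \<partial>lborel)"
    proof -
      have "\<bar>d x powr (1 - 1 / p - \<alpha>) * v x\<bar> powr q = d x powr (n * (t - 1) / (n - t)) * \<bar>v x\<bar> powr q" for x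
        by (simp add: abs_mult powr_mult powr_powr bq)
      then show ?thesis
        using v_supp K_sub integrable_weighted_powr[OF q]
        by (subst set_integral_lebesgue_eq_lborel) auto
    qed
    then have "(\<integral>x\<in>\<Omega>. \<bar>d x powr (1 - 1 / p - \<alpha>) * v x\<bar> powr q \<partial>lebesgue) powr (p / q)
        \<le> M * (\<integral>x. energy p x \<partial>lborel)"
      using subcritical_bound[OF assms(5) t(1), folded n_def, folded q_def]
        supercritical_bound[OF _ t(2), folded n_def, OF _ t(3), folded q_def]
      by (cases "t \<le> 1") (simp_all only: pq M_def if_True if_False not_le[symmetric] simp_thms)
    also have "\<dots> \<le> M / m * (\<integral>x. G x \<partial>lborel)"
    proof -
      have "m * (\<integral>x. energy p x \<partial>lborel) \<le> (\<integral>x. G x \<partial>lborel)"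
        using integral_mono[OF _ G(2) energy_le] integrable_energy[OF assms(5)] by simp
      then have "M / m * (m * (\<integral>x. energy p x \<partial>lborel)) \<le> M / m * (\<integral>x. G x \<partial>lborel)"
        using M m by (intro mult_left_mono) auto
      then show ?thesis using m by simp
    qed
    also have "(\<integral>x. G x \<partial>lborel) = (\<integral>x\<in>\<Omega>. G x \<partial>lebesgue)"
      using G_supp K_sub G(2) by (subst set_integral_lebesgue_eq_lborel) auto
    finally show ?thesis
      by (simp add: G_def d_def)
  qed
  show ?thesis
    using main M m unfolding Let_def q_def t_def n_def
    by (intro exI[of _ "M / m"]) auto
qed

end
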